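(* Let $T>0$, $\xi\in\mathbb{R}^d$, $\tfrac13<\alpha\le\tfrac12$, and let $\mathbf{X}=(X,\mathbb{X})$ be a weak geometric $\alpha$-Hölder rough path over $\mathbb{R}^\ell$ on $[0,T]$. Let $\gamma\in[0,1]$ with $\alpha(2+\gamma)>1$ and let $G\in C_b^{2,\gamma}$. Let $F$ be a set-valued map defined on $[0,T]\times\mathbb{R}^d$ that is upper semicontinuous, locally bounded, and takes its values in the set of nonempty compact convex subsets of $\mathbb{R}^d$. Then there exist a time horizon $T^*\in(0,T)$ and a solution $z$, started from $\xi$ and defined on the time interval $[0,T^*]$, to the rough differential inclusion $$dz_t\in F(t,z_t)\,dt+G(z_t)\,d\mathbf{X}_t .$$
   Context: For a path $y$, write $y_{st}=y_t-y_s$. Function spaces: for an integer $k\ge1$ and $\gamma\in[0,1]$, $C_b^{k,\gamma}$ is the space of bounded maps $G:\mathbb{R}^d\to L(\mathbb{R}^\ell,\mathbb{R}^d)$ that are $k$ times differentiable with bounded derivatives and have a $\gamma$-Hölder $k$-th derivative. Semicontinuity: a set-valued map $F$ is upper semicontinuous if for every point $(s,w)$ and every open neighbourhood $V$ of $F(s,w)$ there is an open neighbourhood $U$ of $(s,w)$ such that $F(t,a)\subset V$ for all $(t,a)\in U$ in the domain of $F$. Rough paths: an $\alpha$-Hölder rough path over $\mathbb{R}^\ell$ on $[0,T]$ is a pair $\mathbf{X}=(X,\mathbb{X})$ with $X:[0,T]\to\mathbb{R}^\ell$ $\alpha$-Hölder, $\mathbb{X}:[0,T]^2\to\mathbb{R}^\ell\otimes\mathbb{R}^\ell$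 with $\sup_{s\ne t}|\mathbb{X}_{st}|/|t-s|^{2\alpha}<\infty$, and $\mathbb{X}_{rt}-\mathbb{X}_{rs}-\mathbb{X}_{st}=X_{rs}\otimes X_{st}$ for $0\le r\le s\le t\le T$. It is weak geometric if the symmetric part of $\mathbb{X}_{st}$ equals $\frac12X_{st}\otimes X_{st}$ for all $s\le t$. Controlled paths: for $\theta>\alpha$, an $\alpha$-Hölder path $z:[0,S]\to\mathbb{R}^d$ is controlled by $X$ with remainder of order $\theta$ if there are $z'\in C^{\theta-\alpha}([0,S],L(\mathbb{R}^\ell,\mathbb{R}^d))$ and $R:[0,S]^2\to\mathbb{R}^d$ with $\sup_{s\ne t}|R_{st}|/|t-s|^\theta<\infty$ and $z_{st}=z'_sX_{st}+R_{st}$; one then calls $(z,z')$ a path controlled by $X$. The same definition is used with $\mathbb{R}^d$ replaced by another finite-dimensional space. Rough integral: if $(z,z')$ is controlled by $X$ with remainder of order $\theta$, $\alpha+\theta>1$, then $(G(z),DG(z)z')$ is a controlled path, and $\int_0^tG(z_s)\,d\mathbf{X}_s$ is the limit, as the mesh of the partition $\{s_i\}$ of $[0,t]$ tends to $0$, of $\sum_i\big(G(z_{s_i})X_{s_is_{i+1}}+(DG(z_{s_i})z'_{s_i})\mathbb{X}_{s_is_{i+1}}\big)$, where $(DG(z)z')(a\otimes b):=(DG(z)[z'a])\,b$. Solution: an $\mathbb{R}^d$-valued path $z$ started from $\xi$ is a solution to $dz_t\in F(t,z_t)dt+G(z_t)d\mathbf{X}_t$ on $[0,T^*]$ if $z$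 is part of a path $(z,z')$ controlled by $X$ (with remainder of some order $\theta>\alpha$ with $\alpha+\theta>1$, so that the rough integral below makes sense), and there is an absolutely continuous path $x:[0,T^*]\to\mathbb{R}^d$ starting from $0$ with $\dot x_t\in F(t,z_t)$ for Lebesgue almost every $t\in[0,T^*]$ and $$z_t=\xi+x_t+\int_0^tG(z_s)\,d\mathbf{X}_s\qquad\text{for all }t\in[0,T^*].$$ *)

theory Defs
  imports "HOL-Analysis.Analysis"
begin

section \<open>Hoelder regularity\<close>

definition increment :: "(real \<Rightarrow> 'a::real_vector) \<Rightarrow> real \<Rightarrow> real \<Rightarrow> 'a"
  where "increment y s t = y t - y s"

definition order_on :: "real \<Rightarrow> real \<Rightarrow> (real \<Rightarrow> real \<Rightarrow> 'a::real_normed_vector) \<Rightarrow> bool"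
  where "order_on \<theta> S R \<longleftrightarrow>
    (\<exists>C. \<forall>s\<in>{0..S}. \<forall>t\<in>{0..S}. s \<noteq> t \<longrightarrow> norm (R s t) / \<bar>t - s\<bar> powr \<theta> \<le> C)"

definition holder_path :: "real \<Rightarrow> real \<Rightarrow> (real \<Rightarrow> 'a::real_normed_vector) \<Rightarrow> bool"
  where "holder_path \<beta> S y \<longleftrightarrow> order_on \<beta> S (increment y)"

text \<open>The witnesses \<open>DG\<close> and \<open>D2G\<close> are the first and second Frechet derivatives of \<open>G\<close>.
  For \<open>\<gamma> = 0\<close> the last clause only repeats the boundedness of \<open>D2G\<close>.\<close>

definition Cb2 :: "real \<Rightarrow> ('a::real_normed_vector \<Rightarrow> 'b::real_normed_vector) \<Rightarrow> bool"
  where "Cb2 \<gamma> G \<longleftrightarrow> bounded (range G) \<and>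
    (\<exists>(DG :: 'a \<Rightarrow> 'a \<Rightarrow>\<^sub>L 'b) (D2G :: 'a \<Rightarrow> 'a \<Rightarrow>\<^sub>L 'a \<Rightarrow>\<^sub>L 'b).
      (\<forall>x. (G has_derivative blinfun_apply (DG x)) (at x)) \<and>
      (\<forall>x. (DG has_derivative blinfun_apply (D2G x)) (at x)) \<and>
      bounded (range DG) \<and> bounded (range D2G) \<and>
      (\<exists>C. \<forall>x y. x \<noteq> y \<longrightarrow> norm (D2G x - D2G y) \<le> C * norm (x - y) powr \<gamma>))"


section \<open>Set-valued maps\<close>

definition upper_semicontinuous_on ::
    "'a::topological_space set \<Rightarrow> ('a \<Rightarrow> 'b::topological_space set) \<Rightarrow> bool"
  where "upper_semicontinuous_on D F \<longleftrightarrow>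
    (\<forall>p\<in>D. \<forall>V. open V \<and> F p \<subseteq> V \<longrightarrow>
      (\<exists>U. open U \<and> p \<in> U \<and> (\<forall>q\<in>U \<inter> D. F q \<subseteq> V)))"

definition locally_bounded_on ::
    "'a::topological_space set \<Rightarrow> ('a \<Rightarrow> 'b::metric_space set) \<Rightarrow> bool"
  where "locally_bounded_on D F \<longleftrightarrow>
    (\<forall>p\<in>D. \<exists>U. open U \<and> p \<in> U \<and> bounded (\<Union>q\<in>U \<inter> D. F q))"


section \<open>Rough paths\<close>

text \<open>The space \<open>\<real>\<^sup>\<ell> \<otimes> \<real>\<^sup>\<ell>\<close> is identified with the \<open>\<ell> \<times> \<ell>\<close> matrices.\<close>

definition tensor :: "real^'l \<Rightarrow> real^'l \<Rightarrow> real^'l^'l"  (infixr \<open>\<otimes>\<^sub>v\<close> 75)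
  where "a \<otimes>\<^sub>v b = (\<chi> i j. a $ i * b $ j)"

definition rough_path ::
    "real \<Rightarrow> real \<Rightarrow> (real \<Rightarrow> real^'l) \<Rightarrow> (real \<Rightarrow> real \<Rightarrow> real^'l^'l) \<Rightarrow> bool"
  where "rough_path \<alpha> T X XX \<longleftrightarrow>
    holder_path \<alpha> T X \<and> order_on (2 * \<alpha>) T XX \<and>
    (\<forall>r s t. 0 \<le> r \<and> r \<le> s \<and> s \<le> t \<and> t \<le> T \<longrightarrow>
      XX r t - XX r s - XX s t = increment X r s \<otimes>\<^sub>v increment X s t)"

definition weak_geometric_rough_path ::
    "real \<Rightarrow> real \<Rightarrow> (real \<Rightarrow> real^'l) \<Rightarrow> (real \<Rightarrow> real \<Rightarrow> real^'l^'l) \<Rightarrow> bool"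
  where "weak_geometric_rough_path \<alpha> T X XX \<longleftrightarrow>
    rough_path \<alpha> T X XX \<and>
    (\<forall>s t. 0 \<le> s \<and> s \<le> t \<and> t \<le> T \<longrightarrow>
      (1/2) *\<^sub>R (XX s t + transpose (XX s t)) =
      (1/2) *\<^sub>R (increment X s t \<otimes>\<^sub>v increment X s t))"

definition controlled_path ::
    "real \<Rightarrow> real \<Rightarrow> real \<Rightarrow> (real \<Rightarrow> real^'l) \<Rightarrow> (real \<Rightarrow> 'e::real_normed_vector) \<Rightarrow>
     (real \<Rightarrow> (real^'l) \<Rightarrow>\<^sub>L 'e) \<Rightarrow> bool"
  where "controlled_path \<alpha> \<theta> S X z z' \<longleftrightarrow>
    \<theta> > \<alpha> \<and> holder_path \<alpha> S z \<and> holder_path (\<theta> - \<alpha>) S z' \<and>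
    (\<exists>R. order_on \<theta> S R \<and>
      (\<forall>s\<in>{0..S}. \<forall>t\<in>{0..S}.
        increment z s t = blinfun_apply (z' s) (increment X s t) + R s t))"


section \<open>Rough integral\<close>

text \<open>The linear map on \<open>\<real>\<^sup>\<ell> \<otimes> \<real>\<^sup>\<ell>\<close> induced by a bilinear map \<open>B\<close>.\<close>

definition tensor_lift :: "(real^'l \<Rightarrow> real^'l \<Rightarrow> 'e::real_vector) \<Rightarrow> real^'l^'l \<Rightarrow> 'e"
  where "tensor_lift B M = (\<Sum>i\<in>UNIV. \<Sum>j\<in>UNIV. (M $ i $ j) *\<^sub>R B (axis i 1) (axis j 1))"

lemma tensor_lift_tensor:
  assumes "bilinear B"
  shows "tensor_lift B (a \<otimes>\<^sub>v b) = B a b"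
proof -
  have "B a b = B (\<Sum>i\<in>UNIV. a $ i *\<^sub>R axis i 1) (\<Sum>j\<in>UNIV. b $ j *\<^sub>R axis j 1)"
    by (simp add: basis_expansion flip: scalar_mult_eq_scaleR)
  also have "\<dots> = (\<Sum>(i, j)\<in>UNIV \<times> UNIV. B (a $ i *\<^sub>R axis i 1) (b $ j *\<^sub>R axis j 1))"
    by (rule bilinear_sum[OF assms])
  also have "\<dots> = tensor_lift B (a \<otimes>\<^sub>v b)"
    by (simp add: tensor_lift_def tensor_def sum.cartesian_product
        bilinear_lmul[OF assms] bilinear_rmul[OF assms] mult.commute)
  finally show ?thesis by simp
qed

definition rough_summand ::
    "(real \<Rightarrow> real^'l) \<Rightarrow> (real \<Rightarrow> real \<Rightarrow> real^'l^'l) \<Rightarrow>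
     ('e::real_normed_vector \<Rightarrow> (real^'l) \<Rightarrow>\<^sub>L 'e) \<Rightarrow>
     (real \<Rightarrow> 'e) \<Rightarrow> (real \<Rightarrow> (real^'l) \<Rightarrow>\<^sub>L 'e) \<Rightarrow> real \<Rightarrow> real \<Rightarrow> 'e"
  where "rough_summand X XX G z z' u v =
    blinfun_apply (G (z u)) (increment X u v) +
    tensor_lift
      (\<lambda>a b. blinfun_apply (frechet_derivative G (at (z u)) (blinfun_apply (z' u) a)) b)
      (XX u v)"

text \<open>A partition \<open>0 = p 0 < \<dots> < p n = t\<close>; for \<open>t = 0\<close> this forces \<open>n = 0\<close>, so integrals over
  \<open>[0, 0]\<close> vanish.\<close>

definition interval_partition :: "real \<Rightarrow> nat \<Rightarrow> (nat \<Rightarrow> real) \<Rightarrow> bool"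
  where "interval_partition t n p \<longleftrightarrow> p 0 = 0 \<and> p n = t \<and> (\<forall>i<n. p i < p (Suc i))"

definition has_rough_integral ::
    "(real \<Rightarrow> real^'l) \<Rightarrow> (real \<Rightarrow> real \<Rightarrow> real^'l^'l) \<Rightarrow>
     ('e::real_normed_vector \<Rightarrow> (real^'l) \<Rightarrow>\<^sub>L 'e) \<Rightarrow>
     (real \<Rightarrow> 'e) \<Rightarrow> (real \<Rightarrow> (real^'l) \<Rightarrow>\<^sub>L 'e) \<Rightarrow> real \<Rightarrow> 'e \<Rightarrow> bool"
  where "has_rough_integral X XX G z z' t I \<longleftrightarrow>
    (\<forall>\<epsilon>>0. \<exists>\<delta>>0. \<forall>n p. interval_partition t n p \<and> (\<forall>i<n. p (Suc i) - p i < \<delta>) \<longrightarrow>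
      norm ((\<Sum>i<n. rough_summand X XX G z z' (p i) (p (Suc i))) - I) < \<epsilon>)"


lemma has_rough_integral_unique:
  assumes "0 \<le> t" "has_rough_integral X XX G z z' t I" "has_rough_integral X XX G z z' t J"
  shows "I = J"
proof (rule ccontr)
  assume "I \<noteq> J"
  define \<epsilon> where "\<epsilon> = norm (I - J) / 2"
  have "\<epsilon> > 0"
    using \<open>I \<noteq> J\<close> by (simp add: \<epsilon>_def)
  define S where "S n p = (\<Sum>i<n. rough_summand X XX G z z' (p i) (p (Suc i)))" for n p
  obtain \<delta>1 where \<delta>1: "\<delta>1 > 0" "\<And>n p. interval_partition t n p \<Longrightarrow>
      \<forall>i<n. p (Suc i) - p i < \<delta>1 \<Longrightarrow> norm (S n p - I) < \<epsilon>"
    using assms(2) \<open>\<epsilon> > 0\<close> unfolding has_rough_integral_def S_def by meson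
  obtain \<delta>2 where \<delta>2: "\<delta>2 > 0" "\<And>n p. interval_partition t n p \<Longrightarrow>
      \<forall>i<n. p (Suc i) - p i < \<delta>2 \<Longrightarrow> norm (S n p - J) < \<epsilon>"
    using assms(3) \<open>\<epsilon> > 0\<close> unfolding has_rough_integral_def S_def by meson
  have "\<exists>n p. interval_partition t n p \<and> (\<forall>i<n. p (Suc i) - p i < min \<delta>1 \<delta>2)"
  proof (cases "t = 0")
    case True
    then have "interval_partition t 0 (\<lambda>_. 0)"
      by (simp add: interval_partition_def)
    then show ?thesis by blast
  next
    case False
    then have "t > 0" using assms(1) by simp
    obtain n :: nat where n: "t / min \<delta>1 \<delta>2 < real n"
      using reals_Archimedean2 by blast
    have "0 < t / min \<delta>1 \<delta>2" using \<open>t > 0\<close> \<delta>1(1) \<delta>2(1) by simp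
    with n have "real n > 0" by linarith
    define p where "p i = t * real i / real n" for i
    have step: "p (Suc i) - p i = t / real n" for i
      by (simp add: p_def distrib_left add_divide_distrib)
    have pos: "t / real n > 0"
      using \<open>t > 0\<close> \<open>real n > 0\<close> by simp
    have "p i < p (Suc i)" for i
      using step[of i] pos by linarith
    then have "interval_partition t n p"
      using \<open>real n > 0\<close> by (auto simp: interval_partition_def p_def)
    moreover have "t / real n < min \<delta>1 \<delta>2"
    proof -
      have "min \<delta>1 \<delta>2 > 0"
        using \<delta>1(1) \<delta>2(1) by simp
      then show ?thesis
        using n \<open>real n > 0\<close> by (metis pos_divide_less_eq mult.commute)
    qed
    ultimately show ?thesis using step by metis
  qed
  then obtain n p where "interval_partition t n p" "\<forall>i<n. p (Suc i) - p i < min \<delta>1 \<delta>2"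
    by blast
  then have "norm (S n p - I) < \<epsilon>" "norm (S n p - J) < \<epsilon>"
    using \<delta>1(2)[of n p] \<delta>2(2)[of n p] by auto
  moreover have "norm (I - J) \<le> norm (S n p - J) + norm (S n p - I)"
    using norm_triangle_ineq4[of "S n p - J" "S n p - I"] by simp
  ultimately show False
    by (simp add: \<epsilon>_def)
qed


section \<open>Solutions of the rough differential inclusion\<close>

definition absolutely_continuous_path :: "real \<Rightarrow> (real \<Rightarrow> 'a::real_normed_vector) \<Rightarrow> bool"
  where "absolutely_continuous_path S x \<longleftrightarrow>
    (\<forall>\<epsilon>>0. \<exists>\<delta>>0. \<forall>(n::nat) a b.
      (\<forall>i<n. 0 \<le> a i \<and> a i \<le> b i \<and> b i \<le> S) \<and>
      (\<forall>i<n. \<forall>j<n. i \<noteq> j \<longrightarrow> {a i<..<b i} \<inter> {a j<..<b j} = {}) \<and>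
      (\<Sum>i<n. b i - a i) < \<delta> \<longrightarrow>
      (\<Sum>i<n. norm (x (b i) - x (a i))) < \<epsilon>)"

definition rdi_solution ::
    "real \<Rightarrow> (real \<Rightarrow> real^'l) \<Rightarrow> (real \<Rightarrow> real \<Rightarrow> real^'l^'l) \<Rightarrow>
     (real \<times> (real^'d) \<Rightarrow> (real^'d) set) \<Rightarrow> (real^'d \<Rightarrow> (real^'l) \<Rightarrow>\<^sub>L (real^'d)) \<Rightarrow>
     real^'d \<Rightarrow> real \<Rightarrow> (real \<Rightarrow> real^'d) \<Rightarrow> bool"
  where "rdi_solution \<alpha> X XX F G \<xi> S z \<longleftrightarrow>
    (\<exists>z' \<theta> x.
      \<alpha> + \<theta> > 1 \<and> controlled_path \<alpha> \<theta> S X z z' \<and>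
      absolutely_continuous_path S x \<and> x 0 = 0 \<and>
      (AE t in lebesgue_on {0..S}.
        \<exists>v\<in>F (t, z t). (x has_vector_derivative v) (at t within {0..S})) \<and>
      (\<forall>t\<in>{0..S}. \<exists>I. has_rough_integral X XX G z z' t I \<and> z t = \<xi> + x t + I))"

end

theory Submission
  imports Defs "HOL-Complex_Analysis.Great_Picard"
begin

text \<open>
  The Euler scheme \<open>y\<^sub>k\<^sub>+\<^sub>1 = y\<^sub>k + h v\<^sub>k + G(y\<^sub>k) X + (DG G)(y\<^sub>k) XX\<close>, with drift \<open>v\<^sub>k \<in> F(t\<^sub>k, y\<^sub>k)\<close>,
  satisfies Davie's local expansion up to an error of order \<open>3\<alpha> > 1\<close>, uniformly in the mesh: the
  defect of the remainder on three grid points is of order \<open>3\<alpha>\<close> on a short time interval, so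
  repeated bisection (a discrete sewing argument) controls the remainder itself. Hence the schemes
  and their drift parts are equicontinuous and Arzela--Ascoli gives a limit \<open>(z, x)\<close> with the same
  expansion. Summing the expansion over a partition identifies \<open>z - \<xi> - x\<close> as the rough
  integral. The path \<open>x\<close> is Lipschitz, hence differentiable almost everywhere; its difference
  quotients at \<open>t\<close> are limits of averages of the \<open>v\<^sub>k\<close>, which by upper semicontinuity lie in any
  given convex neighbourhood of \<open>F(t, z\<^sub>t)\<close>, so the derivative lies in \<open>F(t, z\<^sub>t)\<close>.
\<close>

section \<open>Almost everywhere differentiability of Lipschitz paths\<close>

text \<open>The selected drift has no continuity, so its values along the scheme need not converge
  and the limit drift cannot be identified pointwise. Two devices get around this. In the expansion
  the drift enters as an explicit increment \<open>u\<close> of \<open>remainder\<close>; increments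
  are additive, so the drift cancels in the three-point defect and the sewing sees only its bound.
  And all that is kept of the drift in the limit is which closed convex sets contain its averages, a
  property that survives limits. The sewing estimate looks circular: the defect on r <= s <= t is of
  order 3\<alpha> only if y moves on [r, s] as the expansion predicts. Induction on the length of
  the interval supplies this, and the short horizon keeps the constant from growing. Bisection
  closes because two halves cost 2 * 2^(-3\<alpha>) < 1 times the bound for the whole, which is
  where \<alpha> > 1/3 enters.\<close>

lemma subunit_slope_indefinite_integral:
  fixes F :: "real \<Rightarrow> real"
  assumes mono: "\<And>x y. x \<le> y \<Longrightarrow> F x \<le> F y"
    and slope: "\<And>x y. x \<le> y \<Longrightarrow> F y - F x \<le> y - x"
  obtains g where "\<And>a b. a \<le> b \<Longrightarrow> (g has_integral (F b - F a)) {a..b}"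
proof -
  \<comment> \<open>The slope hypotheses say exactly that \<open>F\<close> and its complement
    \<open>H\<close> are both nondecreasing, so both generate Stieltjes measures.\<close>
  define H where "H x = x - F x" for x
  have monoH: "H x \<le> H y" if "x \<le> y" for x y
    using slope[OF that] by (simp add: H_def)
  have "\<bar>F x - F y\<bar> \<le> \<bar>x - y\<bar>" for x y
    using mono[of x y] slope[of x y] mono[of y x] slope[of y x] by linarith
  then have "1-lipschitz_on UNIV F"
    by (auto simp: lipschitz_on_def dist_real_def)
  then have contF: "continuous_on UNIV F"
    by (rule lipschitz_on_continuous_on)
  then have contH: "continuous_on UNIV H"
    unfolding H_def by (intro continuous_intros)
  \<comment> \<open>Stieltjes measures are given on half-open intervals, whereas
    \<open>lborel_eqI\<close> tests open boxes; continuity of \<open>K\<close> makes the right end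
    point a null set.\<close>
  have box: "emeasure (interval_measure K) {a<..<b} = ennreal (K b - K a)"
    if "a \<le> b" "\<And>x y. x \<le> y \<Longrightarrow> K x \<le> K y" "continuous_on UNIV K"
    for K :: "real \<Rightarrow> real" and a b
  proof -
    have "emeasure (interval_measure K) {b..b} = ennreal (K b - K b)"
      by (rule emeasure_interval_measure_Icc) (use that in auto)
    then have "{b} \<in> null_sets (interval_measure K)"
      by (auto simp: null_sets_def)
    then have "emeasure (interval_measure K) ({a<..b} - {b}) = emeasure (interval_measure K) {a<..b}"
      by (intro emeasure_Diff_null_set) auto
    also have "{a<..b} - {b} = {a<..<b}" by auto
    also have "emeasure (interval_measure K) {a<..b} = ennreal (K b - K a)"
      by (rule emeasure_interval_measure_Ioc)
         (use that in \<open>auto intro: continuous_within_subset simp: continuous_on_eq_continuous_within\<close>)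
    finally show ?thesis .
  qed
  \<comment> \<open>The Stieltjes measures of \<open>F\<close> and of \<open>x - F x\<close> add up to Lebesgue measure, so that of
    \<open>F\<close> is absolutely continuous and has a Radon--Nikodym density.\<close>
  define P where "P = measure_of UNIV (sets borel)
    (\<lambda>A. emeasure (interval_measure F) A + emeasure (interval_measure H) A)"
  have sets_P: "sets P = sets borel"
    using sets.sets_measure_of_eq[of "borel :: real measure"] by (simp add: P_def)
  have emeasure_P: "emeasure P A = emeasure (interval_measure F) A + emeasure (interval_measure H) A"
    if "A \<in> sets borel" for A
  proof (rule emeasure_measure_of[OF P_def])
    show "positive (sets P) (\<lambda>A. emeasure (interval_measure F) A + emeasure (interval_measure H) A)"
      by (simp add: positive_def)
    show "countably_additive (sets P)
        (\<lambda>A. emeasure (interval_measure F) A + emeasure (interval_measure H) A)"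
      by (auto simp: countably_additive_def sets_P suminf_emeasure suminf_add[symmetric])
  qed (use that sets_P in auto)
  have "lborel = P"
  proof (rule lborel_eqI)
    fix l u :: real
    assume "\<And>b. b \<in> Basis \<Longrightarrow> l \<bullet> b \<le> u \<bullet> b"
    then have lu: "l \<le> u" by simp
    have "emeasure P (box l u) = ennreal (F u - F l) + ennreal (H u - H l)"
      by (simp add: emeasure_P box_real box[OF lu mono contF] box[OF lu monoH contH])
    also have "\<dots> = ennreal (u - l)"
      using mono[OF lu] monoH[OF lu] by (simp add: H_def flip: ennreal_plus)
    finally show "emeasure P (box l u) = (\<Prod>b\<in>Basis. (u - l) \<bullet> b)"
      by simp
  qed (rule sets_P)
  then have null: "N \<in> null_sets (interval_measure F)" if "N \<in> null_sets lborel" for N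
    using that emeasure_P by (auto simp: null_sets_def)
  have ac: "absolutely_continuous lborel (interval_measure F)"
    using null by (auto simp: absolutely_continuous_def)
  obtain f where f: "f \<in> borel_measurable lborel" "density lborel f = interval_measure F"
    using sigma_finite_measure.Radon_Nikodym[OF sigma_finite_lborel ac] by auto
  have [measurable]: "f \<in> borel_measurable borel" using f(1) by simp
  have nn: "(\<integral>\<^sup>+x. f x * indicator {a..b} x \<partial>lborel) = ennreal (F b - F a)" if "a \<le> b" for a b
    using emeasure_interval_measure_Icc[OF that mono contF]
    by (simp add: f(2)[symmetric] emeasure_density)
  have "(enn2real \<circ> f has_integral (F b - F a)) {a..b}" if "a \<le> b" for a b
  proof -
    \<comment> \<open>The density takes values in [0, infinity]. Its integral over
      \<open>{a..b}\<close> is finite, so it is finite almost everywhere there and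
      \<open>enn2real\<close> does not change the integral.\<close>
    have "AE x in lborel. f x * indicator {a..b} x \<noteq> \<infinity>"
      by (rule nn_integral_noteq_infinite) (auto simp: nn[OF that])
    then have "(\<integral>\<^sup>+x. ennreal (enn2real (f x) * indicator {a..b} x) \<partial>lborel)
        = (\<integral>\<^sup>+x. f x * indicator {a..b} x \<partial>lborel)"
      by (intro nn_integral_cong_AE) (auto simp: indicator_def top.not_eq_extremum)
    then have "((\<lambda>x. enn2real (f x) * indicator {a..b} x) has_integral (F b - F a)) UNIV"
      using mono[OF that] nn[OF that] by (intro nn_integral_has_integral) auto
    then have "((\<lambda>x. if x \<in> {a..b} then enn2real (f x) else 0) has_integral (F b - F a)) UNIV"
      by (rule has_integral_eq[rotated]) auto
    then show ?thesis
      by (subst (asm) has_integral_restrict_UNIV) (simp add: o_def)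
  qed
  then show ?thesis by (rule that)
qed

text \<open>Rescaling by \<open>L'\<close> and averaging with the identity gives slopes in [0, 1],
  hence an indefinite integral, to which Lebesgue differentiation applies; \<open>f\<close> is
  recovered as L' (2 F - id). The summand 1 in \<open>L'\<close> allows the division also for L =
  0.\<close>

lemma real_lipschitz_AE_differentiable:
  fixes f :: "real \<Rightarrow> real"
  assumes lip: "\<And>x y. \<bar>f x - f y\<bar> \<le> L * \<bar>x - y\<bar>"
  obtains N where "negligible N" "\<And>x. x \<notin> N \<Longrightarrow> f differentiable (at x)"
proof -
  define L' where "L' = \<bar>L\<bar> + 1"
  have L': "L' > 0" and lip': "\<bar>f x - f y\<bar> \<le> L' * \<bar>x - y\<bar>" for x y
    using lip[of x y] mult_right_mono[of L "\<bar>L\<bar> + 1" "\<bar>x - y\<bar>"]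
    by (auto simp: L'_def intro: order_trans)
  define q where "q x = f x / L'" for x
  define F where "F x = (q x + x) / 2" for x
  have quot: "\<bar>q x - q y\<bar> \<le> \<bar>x - y\<bar>" for x y
  proof -
    have "\<bar>q x - q y\<bar> = \<bar>f x - f y\<bar> / L'"
      using L' by (simp add: q_def diff_divide_distrib[symmetric])
    also have "\<dots> \<le> \<bar>x - y\<bar>"
      using L' lip'[of x y] by (simp add: field_simps)
    finally show ?thesis .
  qed
  have F: "F x \<le> F y" "F y - F x \<le> y - x" if "x \<le> y" for x y
    using quot[of x y] that by (simp_all add: F_def abs_le_iff field_simps)
  obtain g where g: "\<And>a b. a \<le> b \<Longrightarrow> (g has_integral (F b - F a)) {a..b}"
    using subunit_slope_indefinite_integral[of F] F by metis
  have g': "((\<lambda>x. g (- x)) has_integral (F (- a) - F (- b))) {a..b}" if "a \<le> b" for a b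
    using g[of "-b" "-a"] that has_integral_reflect_real[of g "F (- a) - F (- b)" "- a" "- b"] by simp
  have int: "g integrable_on cbox a b" "(\<lambda>x. g (- x)) integrable_on cbox a b" for a b
    by (cases "a \<le> b"; use g[of a b] g'[of a b] in \<open>auto simp: integrable_on_def\<close>)+
  \<comment> \<open>The library version of Lebesgue differentiation is one-sided, so it is applied to \<open>g\<close> and to
    its reflection.\<close>
  obtain N1 where N1: "negligible N1" "\<And>x e. x \<notin> N1 \<Longrightarrow> 0 < e \<Longrightarrow> \<exists>d>0. \<forall>h. 0 < h \<and> h < d \<longrightarrow>
               norm (integral (cbox x (x + h *\<^sub>R One)) g /\<^sub>R h ^ DIM(real) - g x) < e"
    by (rule integrable_ccontinuous_explicit[OF int(1)]) blast
  obtain N2 where N2: "negligible N2" "\<And>x e. x \<notin> N2 \<Longrightarrow> 0 < e \<Longrightarrow> \<exists>d>0. \<forall>h. 0 < h \<and> h < d \<longrightarrow>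
               norm (integral (cbox x (x + h *\<^sub>R One)) (\<lambda>x. g (- x)) /\<^sub>R h ^ DIM(real) - g (- x)) < e"
    by (rule integrable_ccontinuous_explicit[OF int(2)]) blast
  have right: "\<exists>d>0. \<forall>h. 0 < h \<and> h < d \<longrightarrow> \<bar>(F (x + h) - F x) / h - g x\<bar> < e"
    if "x \<notin> N1" "0 < e" for x e
  proof -
    have "integral (cbox x (x + h *\<^sub>R One)) g = F (x + h) - F x" if "h > 0" for h
      using g[of x "x + h"] that by (simp add: integral_unique)
    then show ?thesis
      using N1(2)[OF that] by (auto simp: divide_inverse mult.commute) 
  qed
  have left: "\<exists>d>0. \<forall>h. 0 < h \<and> h < d \<longrightarrow> \<bar>(F x - F (x - h)) / h - g x\<bar> < e"
    if "- x \<notin> N2" "0 < e" for x e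
  proof -
    have "integral (cbox (- x) (- x + h *\<^sub>R One)) (\<lambda>x. g (- x)) = F x - F (x - h)" if "h > 0" for h
      using g'[of "- x" "- x + h"] that by (simp add: integral_unique)
    then show ?thesis
      using N2(2)[OF that] by (auto simp: divide_inverse mult.commute) 
  qed
  have "f differentiable (at x)" if "x \<notin> N1 \<union> uminus ` N2" for x
  proof -
    have x: "x \<notin> N1" "- x \<notin> N2" using that by (auto simp: image_iff)
    have "((\<lambda>h. (F (x + h) - F x) / h) \<longlongrightarrow> g x) (at 0)"
    proof (rule LIM_I)
      fix e :: real assume "0 < e"
      obtain d1 where d1: "d1 > 0" "\<And>h. 0 < h \<Longrightarrow> h < d1 \<Longrightarrow> \<bar>(F (x + h) - F x) / h - g x\<bar> < e"
        using right[OF x(1) \<open>0 < e\<close>] by auto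
      obtain d2 where d2: "d2 > 0" "\<And>h. 0 < h \<Longrightarrow> h < d2 \<Longrightarrow> \<bar>(F x - F (x - h)) / h - g x\<bar> < e"
        using left[OF x(2) \<open>0 < e\<close>] by auto
      have "norm ((F (x + h) - F x) / h - g x) < e" if "h \<noteq> 0" "norm (h - 0) < min d1 d2" for h
      proof (cases "h > 0")
        case False
        then show ?thesis
          using d2(2)[of "- h"] that by (simp add: field_simps)
      qed (use d1 that in auto)
      then show "\<exists>s>0. \<forall>h. h \<noteq> 0 \<and> norm (h - 0) < s \<longrightarrow> norm ((F (x + h) - F x) / h - g x) < e"
        using d1(1) d2(1) by (intro exI[of _ "min d1 d2"]) auto
    qed
    then have "(F has_field_derivative g x) (at x)"
      by (simp add: DERIV_def)
    then have "((\<lambda>y. L' * (2 * F y - y)) has_field_derivative L' * (2 * g x - 1)) (at x)"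
      by (auto intro!: derivative_eq_intros)
    also have "(\<lambda>y. L' * (2 * F y - y)) = f"
      using L' by (auto simp: F_def q_def field_simps)
    finally show ?thesis
      using real_differentiable_def by blast
  qed
  moreover have "negligible (N1 \<union> uminus ` N2)"
    using N1(1) N2(1) by (auto intro!: negligible_Un negligible_differentiable_image_negligible derivative_intros)
  ultimately show ?thesis by (rule that[rotated])
qed

lemma lipschitz_AE_vector_differentiable:
  fixes x :: "real \<Rightarrow> 'a::euclidean_space"
  assumes lip: "\<And>s t. norm (x s - x t) \<le> L * \<bar>s - t\<bar>"
  obtains N where "negligible N"
    "\<And>t. t \<notin> N \<Longrightarrow> (x has_vector_derivative vector_derivative x (at t)) (at t)"
proof -
  have "\<bar>x s \<bullet> b - x t \<bullet> b\<bar> \<le> L * \<bar>s - t\<bar>" if "b \<in> Basis" for b s t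
    using Basis_le_norm[OF that, of "x s - x t"] lip[of s t] by (simp add: inner_diff_left)
  then have "\<exists>N. negligible N \<and> (\<forall>t. t \<notin> N \<longrightarrow> (\<lambda>t. x t \<bullet> b) differentiable (at t))" if "b \<in> Basis" for b
    using real_lipschitz_AE_differentiable that by metis
  then obtain N where N: "\<And>b. b \<in> Basis \<Longrightarrow> negligible (N b)"
    "\<And>b t. b \<in> Basis \<Longrightarrow> t \<notin> N b \<Longrightarrow> (\<lambda>t. x t \<bullet> b) differentiable (at t)"
    by metis
  show ?thesis
  proof (rule that)
    show "negligible (\<Union>b\<in>Basis. N b)"
      using N(1) by (intro negligible_Union) auto
    fix t assume "t \<notin> (\<Union>b\<in>Basis. N b)"
    then have "x differentiable (at t)"
      using N(2) by (subst differentiable_componentwise_within) auto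
    then show "(x has_vector_derivative vector_derivative x (at t)) (at t)"
      by (simp add: vector_derivative_works)
  qed
qed

section \<open>Discrete sewing and the Euler scheme\<close>

text \<open>An integer interval cannot always be halved, so [i, j] is cut into [i, m], the single
  step [m, m+1] and [m+1, j], both outer pieces being at most half as long. Two defects are paid,
  the single step contributes nothing, and \<open>KC\<close> says 2 C + 2 K 2^(-\<beta>) \<le> K.
  \<open>delta\<close> may presuppose the bound on its left piece because strong induction on j - i
  provides it.\<close>

lemma discrete_sewing:
  fixes J :: "nat \<Rightarrow> nat \<Rightarrow> 'e::real_normed_vector"
  assumes "1 < \<beta>" "0 \<le> h" "0 \<le> K" and KC: "2 * C \<le> K * (1 - 2 powr (1 - \<beta>))"
    and J0: "\<And>i. J i i = 0" and J1: "\<And>i. i < N \<Longrightarrow> J i (Suc i) = 0"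
    and delta: "\<And>i m j. \<lbrakk>i \<le> m; m \<le> j; j \<le> N; norm (J i m) \<le> K * (h * (real m - real i)) powr \<beta>\<rbrakk>
        \<Longrightarrow> norm (J i j - J i m - J m j) \<le> C * (h * (real j - real i)) powr \<beta>"
    and "i \<le> j" "j \<le> N"
  shows "norm (J i j) \<le> K * (h * (real j - real i)) powr \<beta>"
  using \<open>i \<le> j\<close> \<open>j \<le> N\<close>
proof (induction "j - i" arbitrary: i j rule: less_induct)
  case less
  have C: "0 \<le> C * (h * (real j - real i)) powr \<beta>"
    using order_trans[OF norm_ge_zero delta[of i i j]] less.prems J0 by simp
  consider "j = i" | "j = Suc i" | "2 \<le> j - i" using less.prems by linarith
  then show ?case
  proof cases
    case 3
    define D where "D = h * (real j - real i)"
    have D: "0 \<le> D" using \<open>0 \<le> h\<close> less.prems by (simp add: D_def)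
    define m where "m = i + (j - i) div 2"
    have m: "i \<le> m" "Suc m \<le> j" "m - i < j - i" "j - Suc m < j - i"
      and half: "2 * (m - i) \<le> j - i" "2 * (j - Suc m) \<le> j - i"
      using 3 by (auto simp: m_def)
    have step: "K * (h * (real q - real p)) powr \<beta> \<le> K * 2 powr (- \<beta>) * D powr \<beta>"
      if "2 * (q - p) \<le> j - i" "p \<le> q" for p q
    proof -
      have "2 * (real q - real p) \<le> real j - real i"
        using that less.prems of_nat_le_iff[of "2 * (q - p)" "j - i", where 'a = real]
        by (simp add: of_nat_diff del: of_nat_le_iff)
      then have "h * (2 * (real q - real p)) \<le> D"
        unfolding D_def using \<open>0 \<le> h\<close> by (rule mult_left_mono)
      then have "h * (real q - real p) \<le> D / 2"
        by (simp add: algebra_simps)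
      then have "(h * (real q - real p)) powr \<beta> \<le> (D / 2) powr \<beta>"
        using that \<open>0 \<le> h\<close> \<open>1 < \<beta>\<close> by (intro powr_mono2) auto
      also have "\<dots> = 2 powr (- \<beta>) * D powr \<beta>"
        using D by (simp add: powr_divide powr_minus field_simps)
      finally show ?thesis
        using \<open>0 \<le> K\<close> by (simp add: mult_left_mono mult.assoc)
    qed
    have a1: "norm (J i m) \<le> K * (h * (real m - real i)) powr \<beta>"
      using less.hyps[of m i] m less.prems by simp
    have a2: "norm (J (Suc m) j) \<le> K * (h * (real j - real (Suc m))) powr \<beta>"
      using less.hyps[of j "Suc m"] m less.prems by simp
    have b1: "norm (J i j - J i m - J m j) \<le> C * D powr \<beta>"
      unfolding D_def using delta[OF _ _ _ a1] m less.prems by simp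
    have jm: "J m (Suc m) = 0" using J1 m less.prems by simp
    have "norm (J m j - J m (Suc m) - J (Suc m) j) \<le> C * (h * (real j - real m)) powr \<beta>"
      using delta[of m "Suc m" j] jm m less.prems \<open>0 \<le> K\<close> by simp
    also have "\<dots> \<le> C * D powr \<beta>"
    proof (cases "0 \<le> C")
      case True
      have "h * (real j - real m) \<le> D"
        unfolding D_def using \<open>0 \<le> h\<close> m by (intro mult_left_mono) auto
      then show ?thesis
        using True \<open>1 < \<beta>\<close> \<open>0 \<le> h\<close> m by (intro mult_left_mono powr_mono2) auto
    next
      \<comment> \<open>A negative \<open>C\<close> is compatible with the nonnegative product
        recorded above only if D = 0, that is, only for mesh h = 0.\<close>
      case False
      then have "D powr \<beta> = 0"
        using C powr_ge_zero[of D \<beta>] by (auto simp: D_def zero_le_mult_iff not_le order_antisym)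
      then have "D = 0" by simp
      then have "h = 0" using 3 by (auto simp: D_def)
      then show ?thesis by (simp add: D_def)
    qed
    finally have b2: "norm (J m j - J m (Suc m) - J (Suc m) j) \<le> C * D powr \<beta>" .
    have "J i j = (J i j - J i m - J m j) + (J m j - J m (Suc m) - J (Suc m) j) + J i m + J (Suc m) j"
      by (simp add: jm)
    also have "norm \<dots> \<le> C * D powr \<beta> + C * D powr \<beta> + K * 2 powr (- \<beta>) * D powr \<beta>
        + K * 2 powr (- \<beta>) * D powr \<beta>"
      using b1 b2 order_trans[OF a1 step[of m i]] order_trans[OF a2 step[of j "Suc m"]] half m
      by (intro norm_triangle_mono) auto
    also have "\<dots> = (2 * C + K * 2 powr (1 - \<beta>)) * D powr \<beta>"
      by (simp add: powr_diff powr_minus field_simps)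
    also have "\<dots> \<le> K * D powr \<beta>"
      using KC by (intro mult_right_mono) (auto simp: algebra_simps)
    finally show ?thesis by (simp add: D_def)
  qed (use J0 J1 less.prems \<open>0 \<le> K\<close> in auto)
qed

text \<open>In the application \<open>A y\<close> is the linear map induced by the bilinear map
  \<open>(a, b) \<mapsto> DG y (G y a) b\<close>; \<open>chen\<close> is Chen's relation seen through \<open>A y\<close>. The bound \<open>S_small\<close>
  makes the sewing estimate close: it gives \<open>K d\<^bsup>3\<alpha>\<^esup> \<le> d\<^bsup>2\<alpha>\<^esup>\<close> for \<open>d \<le> S\<close>.\<close>

locale davie_data =
  fixes \<alpha> M S :: real
    and G :: "'e::euclidean_space \<Rightarrow> 'v::real_normed_vector \<Rightarrow>\<^sub>L 'e"
    and DG :: "'e \<Rightarrow> 'e \<Rightarrow>\<^sub>L 'v \<Rightarrow>\<^sub>L 'e"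
    and A :: "'e \<Rightarrow> 'w::real_normed_vector \<Rightarrow>\<^sub>L 'e"
    and X :: "real \<Rightarrow> 'v" and XX :: "real \<Rightarrow> real \<Rightarrow> 'w"
  assumes alpha: "1/3 < \<alpha>" "\<alpha> \<le> 1/2" and M: "1 \<le> M"
    and G_bound: "norm (G y) \<le> M"
    and DG_bound: "norm (DG y) \<le> M"
    and A_bound: "norm (A y) \<le> M"
    and A_lipschitz: "norm (A y' - A y) \<le> M * norm (y' - y)"
    and taylor: "norm (G y' - G y - DG y (y' - y)) \<le> M * (norm (y' - y))\<^sup>2"
    and X_holder: "\<lbrakk>0 \<le> s; s \<le> t; t \<le> S\<rbrakk> \<Longrightarrow> norm (X t - X s) \<le> M * (t - s) powr \<alpha>"
    and XX_holder: "\<lbrakk>0 \<le> s; s \<le> t; t \<le> S\<rbrakk> \<Longrightarrow> norm (XX s t) \<le> M * (t - s) powr (2 * \<alpha>)"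
    and chen: "\<lbrakk>0 \<le> r; r \<le> s; s \<le> t; t \<le> S\<rbrakk> \<Longrightarrow>
      A y (XX r t) = A y (XX r s) + A y (XX s t) + DG y (G y (X s - X r)) (X t - X s)"
    and G_continuous: "continuous_on UNIV G"
    and XX_continuous: "\<lbrakk>s' \<longlonglongrightarrow> s; t' \<longlonglongrightarrow> t; \<And>n. 0 \<le> s' n; \<And>n. s' n \<le> t' n; \<And>n. t' n \<le> S\<rbrakk>
      \<Longrightarrow> (\<lambda>n. XX (s' n) (t' n)) \<longlonglongrightarrow> XX s t"
    and S: "0 < S" "S \<le> 1"
    and S_small: "46 * M ^ 6 / (1 - 2 powr (1 - 3 * \<alpha>)) * S powr \<alpha> \<le> 1"
begin

definition K :: real where "K = 46 * M ^ 6 / (1 - 2 powr (1 - 3 * \<alpha>))"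

definition remainder :: "real \<Rightarrow> real \<Rightarrow> 'e \<Rightarrow> 'e \<Rightarrow> 'e \<Rightarrow> 'e" where
  "remainder s t y y' u = y' - y - u - G y (X t - X s) - A y (XX s t)"

lemma K_denominator: "2 powr (1 - 3 * \<alpha>) < 1"
  using alpha by (simp add: powr_less_one)

lemma K_nonneg: "0 \<le> K"
  using K_denominator M by (simp add: K_def)

text \<open>Apart from G y (X t - X s), the increment consists of drift, \<open>A\<close> term and
  remainder, each at most M^2 d^(2\<alpha>) with d = t - s: the drift because d \<le> 1 and
  2\<alpha> \<le> 1, the remainder by \<open>S_small\<close>. This is the 3; the leading term raises
  it to 4 at order \<alpha>.\<close>

lemma increment_bounds:
  assumes st: "0 \<le> s" "s \<le> t" "t \<le> S" and u: "norm u \<le> M * (t - s)"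
    and rem: "norm (remainder s t y y' u) \<le> K * (t - s) powr (3 * \<alpha>)"
  shows "norm (y' - y - G y (X t - X s)) \<le> 3 * M\<^sup>2 * (t - s) powr (2 * \<alpha>)"
    and "norm (y' - y) \<le> 4 * M\<^sup>2 * (t - s) powr \<alpha>"
proof -
  define d where "d = t - s"
  have d: "0 \<le> d" "d \<le> 1" "d \<le> S" using st S by (auto simp: d_def)
  have M2: "1 \<le> M\<^sup>2" "M \<le> M\<^sup>2" "M * M = M\<^sup>2"
    using M self_le_power[of M 2] one_le_power[of M 2] by (auto simp: power2_eq_square)
  have d2: "0 \<le> d powr (2 * \<alpha>)" by simp
  have "d powr 1 \<le> d powr (2 * \<alpha>)"
    using alpha d by (intro powr_mono') auto
  then have "M * d \<le> M\<^sup>2 * d powr (2 * \<alpha>)"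
    using M2 M d by (intro mult_mono) auto
  with u have 1: "norm u \<le> M\<^sup>2 * d powr (2 * \<alpha>)" by (simp add: d_def)
  have "norm (A y (XX s t)) \<le> M * (M * d powr (2 * \<alpha>))"
    using XX_holder[OF st] A_bound[of y] M norm_blinfun[of "A y" "XX s t"] unfolding d_def
    by (meson mult_mono norm_ge_zero order_trans zero_le_one)
  then have 2: "norm (A y (XX s t)) \<le> M\<^sup>2 * d powr (2 * \<alpha>)"
    by (simp add: power2_eq_square mult.assoc)
  have "K * d powr (3 * \<alpha>) = K * d powr \<alpha> * d powr (2 * \<alpha>)"
    by (simp flip: powr_add)
  also have "\<dots> \<le> 1 * d powr (2 * \<alpha>)"
  proof (rule mult_right_mono)
    have "K * d powr \<alpha> \<le> K * S powr \<alpha>"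
      using alpha d K_nonneg by (intro mult_left_mono powr_mono2) auto
    also have "\<dots> \<le> 1" using S_small by (simp add: K_def)
    finally show "K * d powr \<alpha> \<le> 1" .
  qed simp
  also have "\<dots> \<le> M\<^sup>2 * d powr (2 * \<alpha>)"
    using M2 by (intro mult_right_mono) auto
  finally have 3: "norm (remainder s t y y' u) \<le> M\<^sup>2 * d powr (2 * \<alpha>)"
    using rem by (simp add: d_def)
  have "y' - y - G y (X t - X s) = u + A y (XX s t) + remainder s t y y' u"
    by (simp add: remainder_def)
  also have "norm \<dots> \<le> M\<^sup>2 * d powr (2 * \<alpha>) + M\<^sup>2 * d powr (2 * \<alpha>) + M\<^sup>2 * d powr (2 * \<alpha>)"
    using 1 2 3 by (intro norm_triangle_mono)
  finally have R: "norm (y' - y - G y (X t - X s)) \<le> 3 * M\<^sup>2 * d powr (2 * \<alpha>)" by simp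
  then show "norm (y' - y - G y (X t - X s)) \<le> 3 * M\<^sup>2 * (t - s) powr (2 * \<alpha>)"
    by (simp add: d_def)
  have "norm (G y (X t - X s)) \<le> M * (M * d powr \<alpha>)"
    using X_holder[OF st] G_bound[of y] M norm_blinfun[of "G y" "X t - X s"] unfolding d_def
    by (meson mult_mono norm_ge_zero order_trans zero_le_one)
  then have 4: "norm (G y (X t - X s)) \<le> M\<^sup>2 * d powr \<alpha>"
    by (simp add: power2_eq_square mult.assoc)
  have "d powr (2 * \<alpha>) \<le> d powr \<alpha>"
    using alpha d by (intro powr_mono') auto
  then have "3 * M\<^sup>2 * d powr (2 * \<alpha>) \<le> 3 * M\<^sup>2 * d powr \<alpha>"
    by (intro mult_left_mono) auto
  then have "norm ((y' - y - G y (X t - X s)) + G y (X t - X s)) \<le> 3 * M\<^sup>2 * d powr \<alpha> + M\<^sup>2 * d powr \<alpha>"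
    using R 4 by (intro norm_triangle_mono) auto
  then show "norm (y' - y) \<le> 4 * M\<^sup>2 * (t - s) powr \<alpha>"
    by (simp add: d_def)
qed

text \<open>The three summands of the constant \<open>23 = 16 + 3 + 4\<close> come from the second order Taylor error of
  \<open>G\<close>, the first order error of \<open>y' - y\<close>, and the variation of \<open>A\<close>.\<close>

lemma remainder_delta:
  assumes rst: "0 \<le> r" "r \<le> s" "s \<le> t" "t \<le> S" and u: "norm u \<le> M * (s - r)"
    and rem: "norm (remainder r s y y' u) \<le> K * (s - r) powr (3 * \<alpha>)"
  shows "norm (remainder r t y y'' (u + u') - remainder r s y y' u - remainder s t y' y'' u')
    \<le> 23 * M ^ 6 * (t - r) powr (3 * \<alpha>)"
proof -
  define d where "d = t - r"
  define p where "p = y' - y - G y (X s - X r)"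
  define q where "q = G y' - G y - DG y (y' - y)"
  have M0: "0 \<le> M" using M by simp
  have sS: "s \<le> S" and tS: "0 \<le> s" using rst by auto
  have mono: "(s - r) powr a \<le> d powr a" "(t - s) powr a \<le> d powr a" if "0 \<le> a" for a
    using rst that by (auto simp: d_def intro!: powr_mono2)
  have Xst: "norm (X t - X s) \<le> M * d powr \<alpha>"
    using X_holder[OF tS rst(3,4)] mono[of \<alpha>] alpha M0 by (meson mult_left_mono order_trans less_imp_le
      zero_le_divide_1_iff zero_le_numeral)
  have XXst: "norm (XX s t) \<le> M * d powr (2 * \<alpha>)"
    using XX_holder[OF tS rst(3,4)] mult_left_mono[OF mono(2)[of "2 * \<alpha>"] M0] alpha by linarith
  have p: "norm p \<le> 3 * M\<^sup>2 * d powr (2 * \<alpha>)"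
    using increment_bounds(1)[OF rst(1,2) sS u rem] mult_left_mono[OF mono(1)[of "2 * \<alpha>"], of "3 * M\<^sup>2"] alpha
    by (simp add: p_def)
  have y: "norm (y' - y) \<le> 4 * M\<^sup>2 * d powr \<alpha>"
    using increment_bounds(2)[OF rst(1,2) sS u rem] mult_left_mono[OF mono(1)[of \<alpha>], of "4 * M\<^sup>2"] alpha
    by simp
  have "norm q \<le> M * (norm (y' - y))\<^sup>2"
    by (simp add: q_def taylor)
  also have "\<dots> \<le> M * (4 * M\<^sup>2 * d powr \<alpha>)\<^sup>2"
    using y M0 by (intro mult_left_mono power_mono) auto
  also have "\<dots> = 16 * M ^ 5 * d powr (2 * \<alpha>)"
  proof -
    have "(d powr \<alpha>)\<^sup>2 = d powr (2 * \<alpha>)" "M * (M\<^sup>2)\<^sup>2 = M ^ 5"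
      by (simp_all add: power2_eq_square eval_nat_numeral flip: powr_add)
    then show ?thesis by (simp add: power_mult_distrib)
  qed
  finally have q: "norm q \<le> 16 * M ^ 5 * d powr (2 * \<alpha>)" .
  \<comment> \<open>Chen's relation produces \<open>DG y (G y (X s - X r)) (X t - X s)\<close>,
    which is the part of \<open>DG y (y' - y) (X t - X s)\<close> not carried by \<open>p\<close>.
    The drift cancels. Each remaining summand pairs a factor of order 2\<alpha> with one of order
    \<alpha>.\<close>
  have ident: "remainder r t y y'' (u + u') - remainder r s y y' u - remainder s t y' y'' u'
      = q (X t - X s) + DG y p (X t - X s) + (A y' - A y) (XX s t)"
  proof -
    have "X t - X r = (X t - X s) + (X s - X r)" by simp
    then have "G y (X t - X r) = G y (X t - X s) + G y (X s - X r)"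
      by (simp only: blinfun.add_right)
    then show ?thesis
      by (simp add: remainder_def chen[OF rst] q_def p_def blinfun.diff_left blinfun.diff_right blinfun.add_left)
  qed
  have d3: "d powr (2 * \<alpha>) * d powr \<alpha> = d powr (3 * \<alpha>)"
    by (simp flip: powr_add)
  have 1: "norm (q (X t - X s)) \<le> 16 * M ^ 6 * d powr (3 * \<alpha>)"
  proof -
    have "norm (q (X t - X s)) \<le> norm q * norm (X t - X s)" by (rule norm_blinfun)
    also have "\<dots> \<le> (16 * M ^ 5 * d powr (2 * \<alpha>)) * (M * d powr \<alpha>)"
      using q Xst M0 by (intro mult_mono) auto
    also have "\<dots> = 16 * M ^ 6 * d powr (3 * \<alpha>)"
      by (simp add: eval_nat_numeral flip: d3)
    finally show ?thesis .
  qed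
  have M46: "M ^ 4 \<le> M ^ 6" using M by (intro power_increasing) auto
  have 2: "norm (DG y p (X t - X s)) \<le> 3 * M ^ 6 * d powr (3 * \<alpha>)"
  proof -
    have "norm (DG y p (X t - X s)) \<le> norm (DG y p) * norm (X t - X s)" by (rule norm_blinfun)
    also have "\<dots> \<le> (norm (DG y) * norm p) * norm (X t - X s)"
      by (intro mult_right_mono norm_blinfun) auto
    also have "\<dots> \<le> (M * (3 * M\<^sup>2 * d powr (2 * \<alpha>))) * (M * d powr \<alpha>)"
      using p Xst M0 DG_bound[of y] by (intro mult_mono) auto
    also have "\<dots> = 3 * M ^ 4 * d powr (3 * \<alpha>)"
      by (simp add: power2_eq_square power4_eq_xxxx flip: d3)
    also have "\<dots> \<le> 3 * M ^ 6 * d powr (3 * \<alpha>)"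
      using M46 by (intro mult_right_mono) auto
    finally show ?thesis .
  qed
  have 3: "norm ((A y' - A y) (XX s t)) \<le> 4 * M ^ 6 * d powr (3 * \<alpha>)"
  proof -
    have "norm ((A y' - A y) (XX s t)) \<le> norm (A y' - A y) * norm (XX s t)" by (rule norm_blinfun)
    also have "\<dots> \<le> (M * norm (y' - y)) * norm (XX s t)"
      by (intro mult_right_mono A_lipschitz) auto
    also have "\<dots> \<le> (M * (4 * M\<^sup>2 * d powr \<alpha>)) * (M * d powr (2 * \<alpha>))"
      using y XXst M0 by (intro mult_mono mult_left_mono) auto
    also have "\<dots> = 4 * M ^ 4 * d powr (3 * \<alpha>)"
      by (simp add: power2_eq_square power4_eq_xxxx flip: d3)
    also have "\<dots> \<le> 4 * M ^ 6 * d powr (3 * \<alpha>)"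
      using M46 by (intro mult_right_mono) auto
    finally show ?thesis .
  qed
  have "norm (q (X t - X s) + DG y p (X t - X s) + (A y' - A y) (XX s t))
      \<le> 16 * M ^ 6 * d powr (3 * \<alpha>) + 3 * M ^ 6 * d powr (3 * \<alpha>) + 4 * M ^ 6 * d powr (3 * \<alpha>)"
    using 1 2 3 by (intro norm_triangle_mono)
  then show ?thesis
    by (simp add: ident d_def)
qed

text \<open>One Euler step is the expansion with zero remainder, so the remainder vanishes between
  neighbouring grid points and \<open>discrete_sewing\<close> applies with C = 23 M^6.
  \<open>K\<close> is chosen so that its condition \<open>KC\<close> holds with equality.\<close>

lemma euler_remainder_bound:
  fixes y x v :: "nat \<Rightarrow> 'e"
  assumes N: "0 < N" and h: "h = S / real N"
    and v: "\<And>k. norm (v k) \<le> M"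
    and x: "\<And>k. x (Suc k) = x k + h *\<^sub>R v k"
    and y: "\<And>k. y (Suc k) = y k + h *\<^sub>R v k + G (y k) (X (h * real (Suc k)) - X (h * real k))
                 + A (y k) (XX (h * real k) (h * real (Suc k)))"
    and ij: "i \<le> j" "j \<le> N"
  shows "norm (x j - x i) \<le> M * (h * real j - h * real i)"
    and "norm (remainder (h * real i) (h * real j) (y i) (y j) (x j - x i))
      \<le> K * (h * real j - h * real i) powr (3 * \<alpha>)"
proof -
  have h0: "0 < h" using S N h by simp
  have grid: "0 \<le> h * real i" "h * real i \<le> h * real j" "h * real j \<le> S" if "i \<le> j" "j \<le> N" for i j
  proof -
    have "h * real j \<le> h * real N" using that h0 by simp
    then show "h * real j \<le> S" using N h by simp
  qed (use h0 that in auto)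
  have xb: "norm (x j - x i) \<le> M * (h * real j - h * real i)" if "i \<le> j" for i j
    using that
  proof (induction j rule: dec_induct)
    case (step j)
    have "x (Suc j) - x i = (x j - x i) + h *\<^sub>R v j" by (simp add: x)
    also have "norm \<dots> \<le> M * (h * real j - h * real i) + M * h"
      using step v[of j] h0 by (intro norm_triangle_mono) auto
    finally show ?case by (simp add: algebra_simps)
  qed simp
  then show "norm (x j - x i) \<le> M * (h * real j - h * real i)" using ij by simp
  \<comment> \<open>The diagonal is set to 0 by hand: \<open>discrete_sewing\<close> wants it at
    every index, and beyond N the grid leaves [0, S]. Up to N it is automatic, since
    \<open>XX_holder\<close> forces XX s s = 0.\<close>
  define J where "J i j = (if j = i then 0 else
      remainder (h * real i) (h * real j) (y i) (y j) (x j - x i))" for i j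
  have diag: "remainder (h * real i) (h * real i) (y i) (y i) 0 = 0" if "i \<le> N" for i
  proof -
    have "norm (XX (h * real i) (h * real i)) \<le> 0"
      using XX_holder[of "h * real i" "h * real i"] grid[of i i] that by simp
    then show ?thesis by (simp add: remainder_def)
  qed
  have J: "J i j = remainder (h * real i) (h * real j) (y i) (y j) (x j - x i)" if "i \<le> N" for i j
    using diag that by (simp add: J_def)
  have "norm (J i j) \<le> K * (h * (real j - real i)) powr (3 * \<alpha>)"
  proof (rule discrete_sewing[where C = "23 * M ^ 6" and N = N])
    show "2 * (23 * M ^ 6) \<le> K * (1 - 2 powr (1 - 3 * \<alpha>))"
      using K_denominator alpha by (simp add: K_def)
    show "J i i = 0" for i by (simp add: J_def)
    show "J i (Suc i) = 0" for i
      by (simp add: J_def remainder_def x y)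
    show "norm (J i j - J i m - J m j) \<le> 23 * M ^ 6 * (h * (real j - real i)) powr (3 * \<alpha>)"
      if "i \<le> m" "m \<le> j" "j \<le> N" "norm (J i m) \<le> K * (h * (real m - real i)) powr (3 * \<alpha>)" for i m j
    proof -
      have "norm (remainder (h * real i) (h * real j) (y i) (y j) ((x m - x i) + (x j - x m))
          - remainder (h * real i) (h * real m) (y i) (y m) (x m - x i)
          - remainder (h * real m) (h * real j) (y m) (y j) (x j - x m))
        \<le> 23 * M ^ 6 * (h * real j - h * real i) powr (3 * \<alpha>)"
        using that by (intro remainder_delta grid xb) (auto simp: J right_diff_distrib)
      then show ?thesis
        using that by (simp add: J right_diff_distrib)
    qed
  qed (use alpha h0 K_nonneg ij in auto)
  then show "norm (remainder (h * real i) (h * real j) (y i) (y j) (x j - x i))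
      \<le> K * (h * real j - h * real i) powr (3 * \<alpha>)"
    using ij by (simp add: J right_diff_distrib)
qed

end

section \<open>Passage to the limit\<close>

lemma powr_small:
  fixes a :: real
  assumes "0 < a" "0 \<le> C" "0 < e"
  obtains d where "0 < d" "\<And>r. \<lbrakk>0 \<le> r; r \<le> d\<rbrakk> \<Longrightarrow> C * r powr a < e"
proof
  \<comment> \<open>Dividing by C + 1 instead of C makes the final inequality strict and covers C =
    0.\<close>
  define d where "d = (e / (C + 1)) powr (1 / a)"
  show "0 < d" using assms by (simp add: d_def)
  fix r :: real assume r: "0 \<le> r" "r \<le> d"
  have "r powr a \<le> d powr a" using r assms by (intro powr_mono2) auto
  also have "\<dots> = e / (C + 1)" using assms by (simp add: d_def powr_powr)
  finally have "C * r powr a \<le> C * (e / (C + 1))" using assms by (intro mult_left_mono)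
  also have "\<dots> < e" using assms by (simp add: field_simps)
  finally show "C * r powr a < e" .
qed

text \<open>Arzela--Ascoli needs functions on one fixed interval instead of on changing grids, so
  the grid values are joined linearly. Inside a cell, a fraction q of the increment is controlled by
  q \<le> q^\<beta>; points in different cells are compared through two grid points between them,
  whence the factor 3.\<close>

lemma holder_interpolation:
  fixes u :: "nat \<Rightarrow> 'a::real_normed_vector"
  assumes h: "0 < h" and \<beta>: "0 < \<beta>" "\<beta> \<le> 1"
    and u: "\<And>i j. i \<le> j \<Longrightarrow> norm (u j - u i) \<le> C * (h * real j - h * real i) powr \<beta>"
  obtains w where "\<And>i. w (h * real i) = u i"
    "\<And>s t. \<lbrakk>0 \<le> s; s \<le> t\<rbrakk> \<Longrightarrow> norm (w t - w s) \<le> 3 * C * (t - s) powr \<beta>"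
proof -
  define c where "c t = nat \<lfloor>t / h\<rfloor>" for t
  define w where "w t = u (c t) + (t / h - real (c t)) *\<^sub>R (u (Suc (c t)) - u (c t))" for t
  have cell: "h * real (c t) \<le> t" "t \<le> h * real (Suc (c t))" if "0 \<le> t" for t
  proof -
    have "0 \<le> t / h" using that h by simp
    then have "real (c t) \<le> t / h" "t / h \<le> real (Suc (c t))" unfolding c_def by linarith+
    then show "h * real (c t) \<le> t" "t \<le> h * real (Suc (c t))"
      using h by (simp_all add: field_simps)
  qed
  have C: "0 \<le> C"
    using order_trans[OF norm_ge_zero u[of 0 1]] h by (simp add: zero_le_mult_iff)
  have node: "w (h * real k) = u k" for k
    using h by (simp add: w_def c_def)
  \<comment> \<open>The right end point, which the floor assigns to the next cell, is included so
    that \<open>local\<close> works on closed cells.\<close>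
  have repr: "w t = u k + (t / h - real k) *\<^sub>R (u (Suc k) - u k)"
    if "h * real k \<le> t" "t \<le> h * real (Suc k)" for t k
  proof (cases "t = h * real (Suc k)")
    case True
    then show ?thesis using node[of "Suc k"] h by simp
  next
    case False
    then have "real k \<le> t / h" "t / h < real (Suc k)"
      using that h by (auto simp: field_simps)
    then have "c t = k" unfolding c_def by linarith
    then show ?thesis by (simp add: w_def)
  qed
  have local: "norm (w t - w s) \<le> C * (t - s) powr \<beta>"
    if "h * real k \<le> s" "s \<le> t" "t \<le> h * real (Suc k)" for s t k
  proof -
    define q where "q = (t - s) / h"
    have "t - s \<le> h" using that by (simp add: algebra_simps)
    then have q: "0 \<le> q" "q \<le> 1" using that h by (auto simp: q_def)
    have "w t - w s = ((t / h - real k) - (s / h - real k)) *\<^sub>R (u (Suc k) - u k)"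
      using that by (subst (1 2) repr[of k]) (auto simp: scaleR_diff_left)
    also have "(t / h - real k) - (s / h - real k) = q"
      by (simp add: q_def diff_divide_distrib)
    finally have "norm (w t - w s) = q * norm (u (Suc k) - u k)"
      using q by simp
    also have "\<dots> \<le> q * (C * h powr \<beta>)"
      using q u[of k "Suc k"] by (intro mult_left_mono) (auto simp: algebra_simps)
    also have "\<dots> \<le> q powr \<beta> * (C * h powr \<beta>)"
      using q \<beta> C powr_mono'[of \<beta> 1 q] by (intro mult_right_mono) auto
    also have "\<dots> = C * (t - s) powr \<beta>"
      using that h by (simp add: q_def powr_divide)
    finally show ?thesis .
  qed
  have "norm (w t - w s) \<le> 3 * C * (t - s) powr \<beta>" if st: "0 \<le> s" "s \<le> t" for s t
  proof (cases "c s < c t")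
    case False
    have "c s \<le> c t"
      unfolding c_def using st h by (intro nat_mono floor_mono divide_right_mono) auto
    with False have "norm (w t - w s) \<le> C * (t - s) powr \<beta>"
      using cell[of s] cell[of t] st by (intro local[of "c s"]) auto
    also have "\<dots> \<le> 3 * C * (t - s) powr \<beta>"
      using C by (intro mult_right_mono) auto
    finally show ?thesis .
  next
    case True
    define p where "p = h * real (Suc (c s))"
    define q where "q = h * real (c t)"
    have pq: "s \<le> p" "p \<le> q" "q \<le> t"
      using cell[of s] cell[of t] st True h by (auto simp: p_def q_def)
    have grow: "C * (b - a) powr \<beta> \<le> C * (t - s) powr \<beta>" if "s \<le> a" "a \<le> b" "b \<le> t" for a b
      using that \<beta> C by (intro mult_left_mono powr_mono2) auto
    have 1: "norm (w p - w s) \<le> C * (t - s) powr \<beta>"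
      using local[of "c s" s p] cell[of s] st pq grow[of s p] by (simp add: p_def)
    have 2: "norm (w q - w p) \<le> C * (t - s) powr \<beta>"
      using u[of "Suc (c s)" "c t"] True node grow[of p q] pq by (simp add: p_def q_def del: of_nat_Suc)
    have 3: "norm (w t - w q) \<le> C * (t - s) powr \<beta>"
      using local[of "c t" q t] cell[of t] st pq grow[of q t] by (simp add: q_def)
    have "w t - w s = (w t - w q) + (w q - w p) + (w p - w s)" by simp
    also have "norm \<dots> \<le> C * (t - s) powr \<beta> + C * (t - s) powr \<beta> + C * (t - s) powr \<beta>"
      using 1 2 3 by (intro norm_triangle_mono)
    finally show ?thesis by simp
  qed
  with node show ?thesis by (rule that)
qed

text \<open>The steps telescope, so the quotient is the arithmetic mean of the \<open>v k\<close>
  with i \<le> k < j.\<close>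

lemma convex_average_of_steps:
  fixes x v :: "nat \<Rightarrow> 'a::real_vector"
  assumes "convex C" "\<And>k. x (Suc k) = x k + h *\<^sub>R v k" "0 < h" "i < j"
    and v: "\<And>k. \<lbrakk>i \<le> k; k < j\<rbrakk> \<Longrightarrow> v k \<in> C"
  shows "(1 / (h * real j - h * real i)) *\<^sub>R (x j - x i) \<in> C"
proof -
  have "x j - x i = h *\<^sub>R (\<Sum>k = i..<j. v k)"
    using less_imp_le[OF \<open>i < j\<close>]
    by (induction j rule: dec_induct) (auto simp: assms(2) algebra_simps)
  then have "(1 / (h * real j - h * real i)) *\<^sub>R (x j - x i)
      = (\<Sum>k = i..<j. (1 / (real j - real i)) *\<^sub>R v k)"
    using \<open>0 < h\<close> by (simp add: scaleR_sum_right flip: right_diff_distrib)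
  also have "\<dots> \<in> C"
    using \<open>i < j\<close> v by (intro convex_sum \<open>convex C\<close>) (auto simp: of_nat_diff)
  finally show ?thesis .
qed

text \<open>\<open>V\<close> is any bounded function, since the scheme only forms finite sums of its
  values. The last conclusion records what survives of the drift: averages of discrete drift values
  lie in \<open>C\<close> by convexity, and their limits by closedness. \<open>U\<close> and
  \<open>C\<close> are left free so that upper semicontinuity can choose them later.\<close>

lemma (in davie_data) davie_solution_exists:
  fixes V :: "real \<Rightarrow> 'e \<Rightarrow> 'e" and \<xi> :: 'e
  assumes V: "\<And>t y. norm (V t y) \<le> M"
  obtains z x where "z 0 = \<xi>" "x 0 = 0"
    and "\<And>s t. \<lbrakk>0 \<le> s; s \<le> t; t \<le> S\<rbrakk> \<Longrightarrow> norm (x t - x s) \<le> M * (t - s)"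
    and "\<And>s t. \<lbrakk>0 \<le> s; s \<le> t; t \<le> S\<rbrakk> \<Longrightarrow>
          norm (remainder s t (z s) (z t) (x t - x s)) \<le> K * (t - s) powr (3 * \<alpha>)"
    and "\<And>s C U. \<lbrakk>closed C; convex C; open U; 0 \<le> s; s < S; (s, z s) \<in> U;
          \<forall>t y. (t, y) \<in> U \<and> 0 \<le> t \<and> t \<le> S \<longrightarrow> V t y \<in> C\<rbrakk> \<Longrightarrow>
          \<exists>\<delta>>0. \<forall>t. s < t \<and> t < s + \<delta> \<and> t \<le> S \<longrightarrow> (1 / (t - s)) *\<^sub>R (x t - x s) \<in> C"
proof -
  define h where "h n = S / real (Suc n)" for n
  have h: "0 < h n" for n using S by (simp add: h_def)
  have "\<exists>y. y 0 = \<xi> \<and> (\<forall>k. y (Suc k) = y k + h n *\<^sub>R V (h n * real k) (y k)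
      + G (y k) (X (h n * real (Suc k)) - X (h n * real k))
      + A (y k) (XX (h n * real k) (h n * real (Suc k))))" for n
    by (intro exI[of _ "rec_nat \<xi> (\<lambda>k y. y + h n *\<^sub>R V (h n * real k) y
      + G y (X (h n * real (Suc k)) - X (h n * real k))
      + A y (XX (h n * real k) (h n * real (Suc k))))"]) simp
  then obtain y where y0: "\<And>n. y n 0 = \<xi>"
    and y: "\<And>n k. y n (Suc k) = y n k + h n *\<^sub>R V (h n * real k) (y n k)
      + G (y n k) (X (h n * real (Suc k)) - X (h n * real k))
      + A (y n k) (XX (h n * real k) (h n * real (Suc k)))"
    by metis
  define v where "v n k = V (h n * real k) (y n k)" for n k
  define x where "x n k = (\<Sum>i<k. h n *\<^sub>R v n i)" for n k
  have x: "x n (Suc k) = x n k + h n *\<^sub>R v n k" for n k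
    by (simp add: x_def)
  have grid_S: "h n * real k \<le> S" if "k \<le> Suc n" for n k
  proof -
    have "h n * real k \<le> h n * real (Suc n)" using that h[of n] by (intro mult_left_mono) auto
    then show ?thesis by (simp add: h_def)
  qed
  have xb: "norm (x n j - x n i) \<le> M * (h n * real j - h n * real i)"
    and rb: "norm (remainder (h n * real i) (h n * real j) (y n i) (y n j) (x n j - x n i))
      \<le> K * (h n * real j - h n * real i) powr (3 * \<alpha>)" if "i \<le> j" "j \<le> Suc n" for n i j
    using euler_remainder_bound[of "Suc n" "h n" "v n" "x n" "y n" i j] that V x y
    by (simp_all add: h_def v_def)
  \<comment> \<open>4 M^2 comes from y by \<open>increment_bounds\<close>, and M^2 from the drift
    part, whose Lipschitz bound is weakened to order \<alpha> on lengths at most 1.\<close>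
  define C where "C = 5 * M\<^sup>2"
  have C: "0 \<le> C" by (simp add: C_def)
  \<comment> \<open>Indices past the last grid point are frozen because the interpolation lemma
    wants the bound at all indices. Pairing y with x lets one subsequence serve both.\<close>
  define u where "u n k = (y n (min k (Suc n)), x n (min k (Suc n)))" for n k
  have u_holder: "norm (u n j - u n i) \<le> C * (h n * real j - h n * real i) powr \<alpha>" if "i \<le> j" for n i j
  proof -
    define i' where "i' = min i (Suc n)"
    define j' where "j' = min j (Suc n)"
    define d where "d = h n * real j' - h n * real i'"
    have ij: "i' \<le> j'" "j' \<le> Suc n" using that by (auto simp: i'_def j'_def)
    have "real j' - real i' \<le> real j - real i" using that by (auto simp: i'_def j'_def)
    then have d: "0 \<le> d" "d \<le> h n * real j - h n * real i"
      using h[of n] ij by (simp_all add: d_def flip: right_diff_distrib)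
    have "0 \<le> h n * real i'" using h[of n] by simp
    then have d1: "d \<le> 1" using grid_S[OF ij(2)] S by (simp add: d_def)
    have "norm (u n j - u n i) \<le> norm (y n j' - y n i') + norm (x n j' - x n i')"
      by (simp add: u_def i'_def j'_def norm_Pair_le)
    also have "norm (y n j' - y n i') \<le> 4 * M\<^sup>2 * d powr \<alpha>"
      unfolding d_def using h[of n] ij
      by (intro increment_bounds(2)[OF _ _ grid_S xb rb]) auto
    also have "norm (x n j' - x n i') \<le> M * d"
      unfolding d_def by (rule xb[OF ij])
    also have "M * d \<le> M\<^sup>2 * d powr \<alpha>"
      using M d d1 alpha self_le_power[of M 2] powr_mono'[of \<alpha> 1 d] by (intro mult_mono) auto
    also have "4 * M\<^sup>2 * d powr \<alpha> + M\<^sup>2 * d powr \<alpha> = C * d powr \<alpha>"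
      by (simp add: C_def)
    also have "\<dots> \<le> C * (h n * real j - h n * real i) powr \<alpha>"
      using C d alpha by (intro mult_left_mono powr_mono2) auto
    finally show ?thesis by simp
  qed
  have "\<exists>w. (\<forall>i. w (h n * real i) = u n i) \<and>
      (\<forall>s t. 0 \<le> s \<longrightarrow> s \<le> t \<longrightarrow> norm (w t - w s) \<le> 3 * C * (t - s) powr \<alpha>)" for n
  proof -
    have a: "0 < \<alpha>" "\<alpha> \<le> 1" using alpha by auto
    obtain w where "\<And>i. w (h n * real i) = u n i"
      "\<And>s t. \<lbrakk>0 \<le> s; s \<le> t\<rbrakk> \<Longrightarrow> norm (w t - w s) \<le> 3 * C * (t - s) powr \<alpha>"
      using holder_interpolation[OF h[of n] a u_holder[where n = n]] by blast
    then show ?thesis by (intro exI[of _ w]) simp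
  qed
  then obtain w where w_node: "\<And>n i. w n (h n * real i) = u n i"
    and w: "\<And>n s t. 0 \<le> s \<Longrightarrow> s \<le> t \<Longrightarrow> norm (w n t - w n s) \<le> 3 * C * (t - s) powr \<alpha>"
    by metis
  have w0: "w n 0 = (\<xi>, 0)" for n
    using w_node[of n 0] by (simp add: u_def y0 x_def)
  have \<alpha>0: "0 < \<alpha>" using alpha by simp
  obtain g \<phi> where g: "continuous_on {0..S} g" and \<phi>: "strict_mono (\<phi> :: nat \<Rightarrow> nat)"
    and conv: "\<And>e. 0 < e \<Longrightarrow> \<exists>N. \<forall>n t. n \<ge> N \<and> t \<in> {0..S} \<longrightarrow> norm (w (\<phi> n) t - g t) < e"
  proof (rule Arzela_Ascoli[of "{0..S}" w "norm (\<xi>, 0 :: 'e) + 3 * C * S powr \<alpha>"])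
    fix n t assume t: "t \<in> {0..S}"
    have "norm (w n t) \<le> norm (w n 0) + norm (w n t - w n 0)"
      by (metis add.commute diff_add_cancel norm_triangle_ineq)
    also have "norm (w n t - w n 0) \<le> 3 * C * t powr \<alpha>"
      using w[of 0 t n] t by simp
    also have "\<dots> \<le> 3 * C * S powr \<alpha>"
      using C t \<alpha>0 by (intro mult_left_mono powr_mono2) auto
    finally show "norm (w n t) \<le> norm (\<xi>, 0 :: 'e) + 3 * C * S powr \<alpha>"
      by (simp add: w0)
  next
    fix t e :: real assume t: "t \<in> {0..S}" and e: "0 < e"
    obtain d where d: "0 < d" "\<And>r. \<lbrakk>0 \<le> r; r \<le> d\<rbrakk> \<Longrightarrow> 3 * C * r powr \<alpha> < e"
      using powr_small[OF \<alpha>0 _ e, of "3 * C"] C by auto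
    have "norm (w n t - w n s) < e" if "s \<in> {0..S}" "norm (t - s) < d" for n s
    proof (cases "s \<le> t")
      case True
      then show ?thesis using w[of s t n] d(2)[of "t - s"] that by auto
    next
      case False
      then show ?thesis using w[of t s n] d(2)[of "s - t"] that t by (auto simp: norm_minus_commute)
    qed
    with d(1) show "\<exists>d>0. \<forall>n s. s \<in> {0..S} \<and> norm (t - s) < d \<longrightarrow> norm (w n t - w n s) < e"
      by blast
  qed auto
  define z where "z t = fst (g t)" for t
  define \<eta> where "\<eta> t = snd (g t)" for t
  \<comment> \<open>The estimates hold at grid points only, so each time t is replaced by the last
    grid point \<open>\<tau> n t\<close> at or before it, which tends to t with the mesh.\<close>
  define k where "k n t = nat \<lfloor>t / h (\<phi> n)\<rfloor>" for n t
  define \<tau> where "\<tau> n t = h (\<phi> n) * real (k n t)" for n t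
  have k_mono: "k n s \<le> k n t" if "s \<le> t" for n s t
    unfolding k_def using that h[of "\<phi> n"] by (intro nat_mono floor_mono divide_right_mono) auto
  have \<tau>_mono: "\<tau> n s \<le> \<tau> n t" if "s \<le> t" for n s t
    unfolding \<tau>_def using k_mono[OF that] h[of "\<phi> n"] by (intro mult_left_mono) auto
  have k_le: "k n t \<le> Suc (\<phi> n)" if "t \<in> {0..S}" for n t
  proof -
    have "t / h (\<phi> n) \<le> S / h (\<phi> n)" using that h[of "\<phi> n"] by (intro divide_right_mono) auto
    also have "\<dots> = real (Suc (\<phi> n))" using S by (simp add: h_def)
    finally show ?thesis unfolding k_def by linarith
  qed
  have \<tau>_bounds: "0 \<le> \<tau> n t" "\<tau> n t \<le> t" "t - h (\<phi> n) \<le> \<tau> n t" if "0 \<le> t" for n t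
  proof -
    have "0 \<le> t / h (\<phi> n)" using that h[of "\<phi> n"] by simp
    then have "real (k n t) \<le> t / h (\<phi> n)" "t / h (\<phi> n) - 1 \<le> real (k n t)"
      unfolding k_def by linarith+
    then show "\<tau> n t \<le> t" "t - h (\<phi> n) \<le> \<tau> n t"
      using h[of "\<phi> n"] by (simp_all add: \<tau>_def field_simps)
    show "0 \<le> \<tau> n t" using h[of "\<phi> n"] by (simp add: \<tau>_def)
  qed
  have "(\<lambda>n. h n) \<longlonglongrightarrow> 0"
    unfolding h_def by (rule lim_const_over_n[THEN LIMSEQ_Suc])
  then have h_lim: "(\<lambda>n. h (\<phi> n)) \<longlonglongrightarrow> 0"
    using LIMSEQ_subseq_LIMSEQ[OF _ \<phi>] by (simp add: o_def)
  have \<tau>_lim: "(\<lambda>n. \<tau> n t) \<longlonglongrightarrow> t" if "0 \<le> t" for t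
  proof (rule tendsto_sandwich)
    show "(\<lambda>n. t - h (\<phi> n)) \<longlonglongrightarrow> t" using tendsto_diff[OF tendsto_const h_lim] by simp
  qed (use \<tau>_bounds that in auto)
  \<comment> \<open>Uniform convergence matters here: the evaluation points move with n.\<close>
  have unif: "(\<lambda>n. w (\<phi> n) (f n) - g (f n)) \<longlonglongrightarrow> 0" if "\<And>n. f n \<in> {0..S}" for f
    using conv that by (fastforce simp: LIMSEQ_iff)
  have w_lim: "(\<lambda>n. w (\<phi> n) (\<tau> n t)) \<longlonglongrightarrow> g t" if t: "t \<in> {0..S}" for t
  proof -
    have \<tau>S: "\<tau> n t \<in> {0..S}" for n using \<tau>_bounds[of t n] t by auto
    have "(\<lambda>n. g (\<tau> n t)) \<longlonglongrightarrow> g t"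
      using t \<tau>S by (intro continuous_on_tendsto_compose[OF g] \<tau>_lim) auto
    from tendsto_add[OF unif[of "\<lambda>n. \<tau> n t", OF \<tau>S] this] show ?thesis by simp
  qed
  have w_\<tau>: "w (\<phi> n) (\<tau> n t) = (y (\<phi> n) (k n t), x (\<phi> n) (k n t))" if "t \<in> {0..S}" for n t
    using k_le[OF that] by (simp add: \<tau>_def w_node u_def min_absorb1)
  have y_lim: "(\<lambda>n. y (\<phi> n) (k n t)) \<longlonglongrightarrow> z t" and x_lim: "(\<lambda>n. x (\<phi> n) (k n t)) \<longlonglongrightarrow> \<eta> t"
    if "t \<in> {0..S}" for t
    using tendsto_fst[OF w_lim[OF that]] tendsto_snd[OF w_lim[OF that]] w_\<tau>[OF that]
    by (simp_all add: z_def \<eta>_def)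
  have X_lim: "(\<lambda>n. X (\<tau> n t)) \<longlonglongrightarrow> X t" if t: "t \<in> {0..S}" for t
  proof -
    have "(\<lambda>n. M * (t - \<tau> n t) powr \<alpha>) \<longlonglongrightarrow> M * (t - t) powr \<alpha>"
      using t \<alpha>0 \<tau>_bounds by (intro tendsto_intros \<tau>_lim tendsto_powr') auto
    then have "(\<lambda>n. M * (t - \<tau> n t) powr \<alpha>) \<longlonglongrightarrow> 0" by simp
    moreover have "norm (X t - X (\<tau> n t)) \<le> M * (t - \<tau> n t) powr \<alpha>" for n
      using t \<tau>_bounds[of t n] by (intro X_holder) auto
    ultimately have "(\<lambda>n. X t - X (\<tau> n t)) \<longlonglongrightarrow> 0"
      by (intro Lim_null_comparison[of "\<lambda>n. X t - X (\<tau> n t)" "\<lambda>n. M * (t - \<tau> n t) powr \<alpha>"]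
          always_eventually allI)
    from tendsto_diff[OF tendsto_const[of "X t"] this] show ?thesis by simp
  qed
  have A_continuous: "continuous_on UNIV A"
    using A_lipschitz M by (intro lipschitz_on_continuous_on[of M]) (auto simp: lipschitz_on_def dist_norm)
  show ?thesis
  proof (rule that[of z \<eta>])
    have S0: "0 \<in> {0..S}" using S by simp
    show "z 0 = \<xi>" "\<eta> 0 = 0"
      using LIMSEQ_unique[OF y_lim[OF S0], of \<xi>] LIMSEQ_unique[OF x_lim[OF S0], of 0]
      by (simp_all add: k_def y0 x_def)
  next
    fix s t assume "0 \<le> s" "s \<le> t" "t \<le> S"
    then have st: "s \<in> {0..S}" "t \<in> {0..S}" "s \<le> t" by auto
    have \<tau>s: "(\<lambda>n. \<tau> n s) \<longlonglongrightarrow> s" "(\<lambda>n. \<tau> n t) \<longlonglongrightarrow> t" using st by (auto intro: \<tau>_lim)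
    have le1: "norm (x (\<phi> n) (k n t) - x (\<phi> n) (k n s)) \<le> M * (\<tau> n t - \<tau> n s)" for n
      using xb[OF k_mono k_le] st by (simp add: \<tau>_def)
    have l1: "(\<lambda>n. norm (x (\<phi> n) (k n t) - x (\<phi> n) (k n s))) \<longlonglongrightarrow> norm (\<eta> t - \<eta> s)"
      using st by (intro tendsto_intros x_lim)
    have r1: "(\<lambda>n. M * (\<tau> n t - \<tau> n s)) \<longlonglongrightarrow> M * (t - s)"
      by (intro tendsto_intros \<tau>s)
    show "norm (\<eta> t - \<eta> s) \<le> M * (t - s)"
      using LIMSEQ_le[OF l1 r1] le1 by blast
    have le2: "norm (remainder (\<tau> n s) (\<tau> n t) (y (\<phi> n) (k n s)) (y (\<phi> n) (k n t))
        (x (\<phi> n) (k n t) - x (\<phi> n) (k n s))) \<le> K * (\<tau> n t - \<tau> n s) powr (3 * \<alpha>)" for n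
      using rb[OF k_mono k_le] st by (simp add: \<tau>_def)
    have l2: "(\<lambda>n. norm (remainder (\<tau> n s) (\<tau> n t) (y (\<phi> n) (k n s)) (y (\<phi> n) (k n t))
        (x (\<phi> n) (k n t) - x (\<phi> n) (k n s)))) \<longlonglongrightarrow> norm (remainder s t (z s) (z t) (\<eta> t - \<eta> s))"
      unfolding remainder_def
    proof (intro tendsto_intros x_lim y_lim X_lim st blinfun.tendsto)
      show "(\<lambda>n. G (y (\<phi> n) (k n s))) \<longlonglongrightarrow> G (z s)"
        using continuous_on_tendsto_compose[OF G_continuous y_lim] st by simp
      show "(\<lambda>n. A (y (\<phi> n) (k n s))) \<longlonglongrightarrow> A (z s)"
        using continuous_on_tendsto_compose[OF A_continuous y_lim] st by simp
      show "(\<lambda>n. XX (\<tau> n s) (\<tau> n t)) \<longlonglongrightarrow> XX s t"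
      proof (rule XX_continuous[OF \<tau>s])
        show "0 \<le> \<tau> n s" "\<tau> n s \<le> \<tau> n t" "\<tau> n t \<le> S" for n
          using \<tau>_bounds(1)[of s n] \<tau>_bounds(2)[of t n] \<tau>_mono[of s t n] st by auto
      qed
    qed
    have r2: "(\<lambda>n. K * (\<tau> n t - \<tau> n s) powr (3 * \<alpha>)) \<longlonglongrightarrow> K * (t - s) powr (3 * \<alpha>)"
      using \<alpha>0 \<tau>_mono[OF st(3)] by (intro tendsto_intros \<tau>s tendsto_powr') auto
    show "norm (remainder s t (z s) (z t) (\<eta> t - \<eta> s)) \<le> K * (t - s) powr (3 * \<alpha>)"
      using LIMSEQ_le[OF l2 r2] le2 by blast
  next
    fix s C U assume C: "closed C" "convex C" and U: "open U" "(s, z s) \<in> U" and s: "0 \<le> s" "s < S"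
      and VC: "\<forall>t y. (t, y) \<in> U \<and> 0 \<le> t \<and> t \<le> S \<longrightarrow> V t y \<in> C"
    obtain r where r: "0 < r" "ball (s, z s) r \<subseteq> U" using U openE by blast
    have z_cont: "continuous_on {0..S} z" unfolding z_def by (intro continuous_intros g)
    obtain d where d: "0 < d" "\<And>t. \<lbrakk>t \<in> {0..S}; dist t s < d\<rbrakk> \<Longrightarrow> dist (z t) (z s) < r / 3"
    proof -
      have "s \<in> {0..S}" "0 < r / 3" using s r(1) by auto
      then show ?thesis using z_cont[unfolded continuous_on_iff] that by blast
    qed
    obtain N where N: "\<And>n t. \<lbrakk>n \<ge> N; t \<in> {0..S}\<rbrakk> \<Longrightarrow> norm (w (\<phi> n) t - g t) < r / 3"
      using conv[of "r / 3"] r(1) by auto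
    \<comment> \<open>The radius r is split in three: time distance, movement of z, and distance
      between scheme and limit.\<close>
    define \<delta> where "\<delta> = min d (r / 3)"
    have vC: "v (\<phi> n) i \<in> C" if "n \<ge> N" "\<bar>h (\<phi> n) * real i - s\<bar> < \<delta>" "i \<le> Suc (\<phi> n)" for n i
    proof -
      define t where "t = h (\<phi> n) * real i"
      have t: "t \<in> {0..S}" using grid_S[OF that(3)] h[of "\<phi> n"] by (simp add: t_def)
      have "dist (y (\<phi> n) i) (z t) \<le> norm (w (\<phi> n) t - g t)"
        using w_node[of "\<phi> n" i] that(3) dist_fst_le[of "w (\<phi> n) t" "g t"]
        by (simp add: t_def u_def min_absorb1 z_def dist_norm)
      also have "\<dots> < r / 3" using N that t by simp
      finally have "dist (y (\<phi> n) i) (z s) < r / 3 + r / 3"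
        using d(2)[of t] that t dist_triangle[of "y (\<phi> n) i" "z s" "z t"] 
        by (auto simp: \<delta>_def t_def dist_real_def)
      moreover have "dist t s < r / 3" using that by (simp add: \<delta>_def t_def dist_real_def)
      moreover have "dist (t, y (\<phi> n) i) (s, z s) \<le> dist t s + dist (y (\<phi> n) i) (z s)"
        by (simp add: dist_Pair_Pair sqrt_sum_squares_le_sum)
      ultimately have "(t, y (\<phi> n) i) \<in> ball (s, z s) r" by (simp add: dist_commute)
      then show ?thesis using VC r(2) t by (auto simp: v_def t_def)
    qed
    show "\<exists>\<delta>>0. \<forall>t. s < t \<and> t < s + \<delta> \<and> t \<le> S \<longrightarrow> (1 / (t - s)) *\<^sub>R (\<eta> t - \<eta> s) \<in> C"
    proof (intro exI[of _ \<delta>] conjI allI impI)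
      show "0 < \<delta>" using d r by (simp add: \<delta>_def)
      fix t assume "s < t \<and> t < s + \<delta> \<and> t \<le> S"
      then have t: "s < t" "t < s + \<delta>" "t \<le> S" by auto
      have \<tau>s: "(\<lambda>n. \<tau> n s) \<longlonglongrightarrow> s" "(\<lambda>n. \<tau> n t) \<longlonglongrightarrow> t" using s t by (auto intro: \<tau>_lim)
      \<comment> \<open>The midpoint eventually separates \<open>\<tau> n s\<close> from
        \<open>\<tau> n t\<close>, so at least one Euler step lies between them; the third bound
        keeps all these steps within \<open>\<delta>\<close> of s.\<close>
      have "s < (s + t) / 2" "(s + t) / 2 < t" "s - \<delta> < s" using t \<open>0 < \<delta>\<close> by auto
      note order_tendstoD(2)[OF \<tau>s(1) this(1)] order_tendstoD(1)[OF \<tau>s(2) this(2)]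
        order_tendstoD(1)[OF \<tau>s(1) this(3)]
      with eventually_ge_at_top[of N]
      have ev: "\<forall>\<^sub>F n in sequentially. (1 / (\<tau> n t - \<tau> n s)) *\<^sub>R
          (x (\<phi> n) (k n t) - x (\<phi> n) (k n s)) \<in> C"
      proof eventually_elim
        case (elim n)
        have "k n s < k n t"
        proof -
          have "h (\<phi> n) * real (k n s) < h (\<phi> n) * real (k n t)"
            using elim by (simp add: \<tau>_def)
          then show ?thesis using h[of "\<phi> n"] by (simp add: mult_less_cancel_left_pos)
        qed
        have tS: "t \<in> {0..S}" "0 \<le> t" using s t by auto
        show ?case unfolding \<tau>_def
        proof (rule convex_average_of_steps[where x = "x (\<phi> n)" and v = "v (\<phi> n)",
            OF C(2) x h \<open>k n s < k n t\<close>])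
          fix i assume i: "k n s \<le> i" "i < k n t"
          then have "\<tau> n s \<le> h (\<phi> n) * real i" "h (\<phi> n) * real i \<le> \<tau> n t"
            using h[of "\<phi> n"] by (auto simp: \<tau>_def)
          then show "v (\<phi> n) i \<in> C"
            using elim i k_le[OF tS(1), of n] \<tau>_bounds[OF tS(2), of n] t by (intro vC) auto
        qed
      qed
      have lim: "(\<lambda>n. (1 / (\<tau> n t - \<tau> n s)) *\<^sub>R (x (\<phi> n) (k n t) - x (\<phi> n) (k n s)))
          \<longlonglongrightarrow> (1 / (t - s)) *\<^sub>R (\<eta> t - \<eta> s)"
        using s t by (intro tendsto_intros \<tau>s x_lim) auto
      show "(1 / (t - s)) *\<^sub>R (\<eta> t - \<eta> s) \<in> C"
        by (rule Lim_in_closed_set[OF C(1) ev sequentially_bot lim])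
    qed
  qed
qed

section \<open>From the local expansion to solutions of the inclusion\<close>

lemma order_on_bound:
  assumes "order_on \<theta> S R"
  obtains C where "0 \<le> C"
    "\<And>s t. \<lbrakk>s \<in> {0..S}; t \<in> {0..S}; s \<noteq> t\<rbrakk> \<Longrightarrow> norm (R s t) \<le> C * \<bar>t - s\<bar> powr \<theta>"
proof -
  obtain C where C: "norm (R s t) / \<bar>t - s\<bar> powr \<theta> \<le> C" if "s \<in> {0..S}" "t \<in> {0..S}" "s \<noteq> t" for s t
    using assms unfolding order_on_def by blast
  show ?thesis
  proof (rule that[of "\<bar>C\<bar>"])
    fix s t assume st: "s \<in> {0..S}" "t \<in> {0..S}" "s \<noteq> t"
    have "norm (R s t) / \<bar>t - s\<bar> powr \<theta> \<le> \<bar>C\<bar>" using C[OF st] by linarith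
    then show "norm (R s t) \<le> \<bar>C\<bar> * \<bar>t - s\<bar> powr \<theta>"
      using st by (simp add: field_simps)
  qed simp
qed

text \<open>\<open>order_on\<close> quantifies over both orders of the two times, so a remainder has
  to be estimated backwards in time as well as forwards.\<close>

lemma order_onI:
  assumes "\<And>s t. \<lbrakk>0 \<le> s; s < t; t \<le> S\<rbrakk> \<Longrightarrow> norm (R s t) \<le> C * (t - s) powr \<theta>"
    and "\<And>s t. \<lbrakk>0 \<le> s; s < t; t \<le> S\<rbrakk> \<Longrightarrow> norm (R t s) \<le> C * (t - s) powr \<theta>"
  shows "order_on \<theta> S R"
  unfolding order_on_def
proof (intro exI[of _ C] ballI impI)
  fix s t assume st: "s \<in> {0..S}" "t \<in> {0..S}" "s \<noteq> t"
  have "norm (R s t) \<le> C * \<bar>t - s\<bar> powr \<theta>"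
    using assms(1)[of s t] assms(2)[of t s] st by (cases "s < t") auto
  then show "norm (R s t) / \<bar>t - s\<bar> powr \<theta> \<le> C"
    using st by (simp add: field_simps)
qed

lemma holder_pathI:
  assumes "\<And>s t. \<lbrakk>0 \<le> s; s < t; t \<le> S\<rbrakk> \<Longrightarrow> norm (y t - y s) \<le> C * (t - s) powr \<beta>"
  shows "holder_path \<beta> S y"
  unfolding holder_path_def
  using assms by (intro order_onI[of S _ C]) (auto simp: increment_def norm_minus_commute)

lemma holder_path_bound:
  assumes "holder_path \<beta> S y"
  obtains C where "0 \<le> C" "\<And>s t. \<lbrakk>0 \<le> s; s \<le> t; t \<le> S\<rbrakk> \<Longrightarrow> norm (y t - y s) \<le> C * (t - s) powr \<beta>"
proof -
  obtain C where C: "0 \<le> C"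
    "\<And>s t. \<lbrakk>s \<in> {0..S}; t \<in> {0..S}; s \<noteq> t\<rbrakk> \<Longrightarrow> norm (increment y s t) \<le> C * \<bar>t - s\<bar> powr \<beta>"
    using assms order_on_bound unfolding holder_path_def by metis
  have "norm (y t - y s) \<le> C * (t - s) powr \<beta>" if "0 \<le> s" "s \<le> t" "t \<le> S" for s t
    using C(2)[of s t] that by (cases "s = t") (auto simp: increment_def)
  then show ?thesis using C(1) that by blast
qed

lemma holder_path_continuous:
  assumes "holder_path \<beta> S y" "0 < \<beta>"
  shows "continuous_on {0..S} y"
proof -
  obtain C where C: "0 \<le> C"
    "\<And>s t. \<lbrakk>0 \<le> s; s \<le> t; t \<le> S\<rbrakk> \<Longrightarrow> norm (y t - y s) \<le> C * (t - s) powr \<beta>"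
    using holder_path_bound[OF assms(1)] by metis
  show ?thesis
    unfolding continuous_on_iff
  proof (intro ballI allI impI)
    fix s e :: real assume s: "s \<in> {0..S}" and e: "0 < e"
    obtain d where d: "0 < d" "\<And>r. \<lbrakk>0 \<le> r; r \<le> d\<rbrakk> \<Longrightarrow> C * r powr \<beta> < e"
      using powr_small[OF assms(2) C(1) e] by metis
    have "dist (y t) (y s) < e" if "t \<in> {0..S}" "dist t s < d" for t
    proof (cases "s \<le> t")
      case True
      then show ?thesis using C(2)[of s t] d(2)[of "t - s"] that s by (auto simp: dist_norm)
    next
      case False
      then show ?thesis using C(2)[of t s] d(2)[of "s - t"] that s
        by (auto simp: dist_norm norm_minus_commute)
    qed
    with d(1) show "\<exists>d>0. \<forall>t\<in>{0..S}. dist t s < d \<longrightarrow> dist (y t) (y s) < e" by blast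
  qed
qed

section \<open>The second level of the rough path\<close>

lemma norm_tensor: "norm (a \<otimes>\<^sub>v b) = norm a * norm b"
proof -
  have "(a \<otimes>\<^sub>v b) $ i = (a $ i) *\<^sub>R b" for i
    by (simp add: tensor_def vec_eq_iff)
  then have "norm (a \<otimes>\<^sub>v b) = L2_set (\<lambda>i. norm (a $ i) * norm b) UNIV"
    by (simp add: norm_vec_def[of "a \<otimes>\<^sub>v b"])
  then show ?thesis
    by (simp add: norm_vec_def[of a] L2_set_left_distrib)
qed

text \<open>Chen's relation based at 0 expresses XX s t through the one-parameter paths
  \<open>XX 0\<close> and \<open>X\<close>. The first is \<alpha>-Hoelder, its increment being XX s
  t plus a tensor term of order \<alpha>. Chen's relation concerns ordered times, hence the ordering
  of the two sequences.\<close>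

lemma rough_path_continuous:
  assumes rp: "rough_path \<alpha> T X XX" and "0 < \<alpha>"
    and lim: "s' \<longlonglongrightarrow> s" "t' \<longlonglongrightarrow> t"
    and st: "\<And>n. 0 \<le> s' n" "\<And>n. s' n \<le> t' n" "\<And>n. t' n \<le> T"
  shows "(\<lambda>n. XX (s' n) (t' n)) \<longlonglongrightarrow> XX s t"
proof -
  have X: "holder_path \<alpha> T X" and XX: "order_on (2 * \<alpha>) T XX"
    and chen: "\<And>r s t. \<lbrakk>0 \<le> r; r \<le> s; s \<le> t; t \<le> T\<rbrakk> \<Longrightarrow>
      XX r t - XX r s - XX s t = increment X r s \<otimes>\<^sub>v increment X s t"
    using rp unfolding rough_path_def by blast+
  obtain C where C: "0 \<le> C"
    "\<And>s t. \<lbrakk>0 \<le> s; s \<le> t; t \<le> T\<rbrakk> \<Longrightarrow> norm (X t - X s) \<le> C * (t - s) powr \<alpha>"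
    using holder_path_bound[OF X] by metis
  obtain C' where C': "0 \<le> C'"
    "\<And>s t. \<lbrakk>s \<in> {0..T}; t \<in> {0..T}; s \<noteq> t\<rbrakk> \<Longrightarrow> norm (XX s t) \<le> C' * \<bar>t - s\<bar> powr (2 * \<alpha>)"
    using order_on_bound[OF XX] by metis
  have "holder_path \<alpha> T (XX 0)"
  proof (rule holder_pathI)
    fix s t assume st: "0 \<le> s" "s < t" "t \<le> T"
    define d where "d = t - s"
    have d: "0 < d" "d \<le> T" using st by (auto simp: d_def)
    have "XX 0 t - XX 0 s = XX s t + increment X 0 s \<otimes>\<^sub>v increment X s t"
      using chen[of 0 s t] st by (simp add: algebra_simps)
    also have "norm \<dots> \<le> norm (XX s t) + norm (X s - X 0) * norm (X t - X s)"
      by (metis increment_def norm_tensor norm_triangle_ineq)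
    also have "\<dots> \<le> C' * (d powr \<alpha> * T powr \<alpha>) + (C * T powr \<alpha>) * (C * d powr \<alpha>)"
    proof (rule add_mono)
      have "norm (XX s t) \<le> C' * (d powr \<alpha> * d powr \<alpha>)"
        using C'(2)[of s t] st by (simp add: d_def flip: powr_add)
      also have "\<dots> \<le> C' * (d powr \<alpha> * T powr \<alpha>)"
        using C'(1) d \<open>0 < \<alpha>\<close> by (intro mult_left_mono powr_mono2) auto
      finally show "norm (XX s t) \<le> C' * (d powr \<alpha> * T powr \<alpha>)" .
      have "norm (X s - X 0) \<le> C * s powr \<alpha>" using C(2)[of 0 s] st by simp
      also have "\<dots> \<le> C * T powr \<alpha>"
        using C(1) st \<open>0 < \<alpha>\<close> by (intro mult_left_mono powr_mono2) auto
      finally show "norm (X s - X 0) * norm (X t - X s) \<le> (C * T powr \<alpha>) * (C * d powr \<alpha>)"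
        using C(2)[of s t] C(1) st by (intro mult_mono) (auto simp: d_def)
    qed
    also have "\<dots> = (C' * T powr \<alpha> + C * T powr \<alpha> * C) * (t - s) powr \<alpha>"
      by (simp add: d_def algebra_simps)
    finally show "norm (XX 0 t - XX 0 s) \<le> (C' * T powr \<alpha> + C * T powr \<alpha> * C) * (t - s) powr \<alpha>" .
  qed
  then have cont: "continuous_on {0..T} (XX 0)" "continuous_on {0..T} X"
    using X \<open>0 < \<alpha>\<close> by (auto intro: holder_path_continuous)
  have in_T: "s' n \<in> {0..T}" "t' n \<in> {0..T}" for n
    using st[of n] by (auto intro: order_trans)
  have mem: "s \<in> {0..T}" "t \<in> {0..T}"
    using closed_sequentially[OF closed_atLeastAtMost] lim in_T by blast+
  have "s \<le> t" using LIMSEQ_le[OF lim] st by blast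
  have eq: "XX a b = XX 0 b - XX 0 a - (X a - X 0) \<otimes>\<^sub>v (X b - X a)" if "0 \<le> a" "a \<le> b" "b \<le> T" for a b
    using chen[of 0 a b] that by (simp add: increment_def algebra_simps)
  have "(\<lambda>n. XX 0 (t' n) - XX 0 (s' n) - (X (s' n) - X 0) \<otimes>\<^sub>v (X (t' n) - X (s' n)))
      \<longlonglongrightarrow> XX 0 t - XX 0 s - (X s - X 0) \<otimes>\<^sub>v (X t - X s)"
    unfolding tensor_def
    by (intro tendsto_intros continuous_on_tendsto_compose[OF cont(1)]
        continuous_on_tendsto_compose[OF cont(2)] lim mem always_eventually allI in_T)
  moreover have "XX (s' n) (t' n) = XX 0 (t' n) - XX 0 (s' n) - (X (s' n) - X 0) \<otimes>\<^sub>v (X (t' n) - X (s' n))" for n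
    by (rule eq[OF st])
  moreover have "XX s t = XX 0 t - XX 0 s - (X s - X 0) \<otimes>\<^sub>v (X t - X s)"
    using mem \<open>s \<le> t\<close> by (intro eq) auto
  ultimately show ?thesis by simp
qed

section \<open>Linear maps on matrices induced by bilinear maps\<close>

lemma tensor_lift_bounded_linear: "bounded_linear (tensor_lift B)"
  for B :: "real^'l \<Rightarrow> real^'l \<Rightarrow> 'e::real_normed_vector"
  unfolding linear_conv_bounded_linear[symmetric]
  by (rule linearI) (simp_all add: tensor_lift_def scaleR_add_left sum.distrib scaleR_sum_right)

text \<open>Packaged as a bounded linear map so that the dependence of \<open>A y\<close> on y can
  be measured in operator norm, as \<open>davie_data\<close> requires.\<close>

definition tensor_blinfun ::
    "((real^'l) \<Rightarrow>\<^sub>L (real^'l) \<Rightarrow>\<^sub>L 'e::real_normed_vector) \<Rightarrow> (real^'l^'l) \<Rightarrow>\<^sub>L 'e"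
  where "tensor_blinfun B = Blinfun (tensor_lift (\<lambda>a b. B a b))"

lemma tensor_blinfun_apply: "tensor_blinfun B m = tensor_lift (\<lambda>a b. B a b) m"
  by (simp add: tensor_blinfun_def bounded_linear_Blinfun_apply tensor_lift_bounded_linear)

lemma tensor_blinfun_diff: "tensor_blinfun (B - B') = tensor_blinfun B - tensor_blinfun B'"
  by (rule blinfun_eqI)
    (simp add: tensor_blinfun_apply blinfun.diff_left tensor_lift_def scaleR_diff_right sum_subtractf)

lemma norm_tensor_blinfun:
  "norm (tensor_blinfun B) \<le> (real CARD('l))\<^sup>2 * norm B"
  for B :: "(real^'l) \<Rightarrow>\<^sub>L (real^'l) \<Rightarrow>\<^sub>L 'e::real_normed_vector"
proof (rule norm_blinfun_bound)
  fix m :: "real^'l^'l"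
  have "norm ((m $ i $ j) *\<^sub>R B (axis i 1) (axis j 1)) \<le> norm m * norm B" for i j
  proof -
    have "norm (B (axis i 1) (axis j 1)) \<le> norm (B (axis i 1)) * norm (axis j (1::real) :: real^'l)"
      by (rule norm_blinfun)
    also have "norm (B (axis i 1)) \<le> norm B * norm (axis i (1::real) :: real^'l)"
      by (rule norm_blinfun)
    finally have "norm (B (axis i 1) (axis j 1)) \<le> norm B" by simp
    moreover have "\<bar>m $ i $ j\<bar> \<le> norm m"
      by (metis Finite_Cartesian_Product.norm_nth_le norm_nth_le order_trans real_norm_def)
    ultimately show ?thesis by (auto intro!: mult_mono)
  qed
  then have "norm (\<Sum>i\<in>UNIV. \<Sum>j\<in>UNIV. (m $ i $ j) *\<^sub>R B (axis i 1) (axis j 1))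
      \<le> (\<Sum>i\<in>(UNIV :: 'l set). \<Sum>j\<in>(UNIV :: 'l set). norm m * norm B)"
    by (intro sum_norm_le)
  then show "norm (tensor_blinfun B m) \<le> (real CARD('l))\<^sup>2 * norm B * norm m"
    by (simp add: tensor_blinfun_apply tensor_lift_def power2_eq_square mult_ac)
qed simp

text \<open>For steps d \<le> \<delta> a defect of order d^\<beta> is at most \<delta>^(\<beta>-1)
  d. The steps add up to t, so the total defect vanishes with the mesh because \<beta> > 1. The
  increments of y telescope, which identifies the limit and shows its existence at once.\<close>

lemma has_rough_integral_if_davie:
  assumes \<beta>: "1 < \<beta>" and K: "0 \<le> K" and t: "0 \<le> t" "t \<le> S"
    and bound: "\<And>s t. \<lbrakk>0 \<le> s; s \<le> t; t \<le> S\<rbrakk> \<Longrightarrow>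
      norm (y t - y s - rough_summand X XX G z z' s t) \<le> K * (t - s) powr \<beta>"
  shows "has_rough_integral X XX G z z' t (y t - y 0)"
  unfolding has_rough_integral_def
proof (intro allI impI)
  fix \<epsilon> :: real assume "0 < \<epsilon>"
  have "0 < \<beta> - 1" "0 \<le> K * t" using \<beta> K t by auto
  then obtain \<delta> where \<delta>: "0 < \<delta>" "\<And>r. \<lbrakk>0 \<le> r; r \<le> \<delta>\<rbrakk> \<Longrightarrow> K * t * r powr (\<beta> - 1) < \<epsilon>"
    using powr_small[OF _ _ \<open>0 < \<epsilon>\<close>] by metis
  have "norm ((\<Sum>i<n. rough_summand X XX G z z' (p i) (p (Suc i))) - (y t - y 0)) < \<epsilon>"
    if p: "interval_partition t n p" and mesh: "\<forall>i<n. p (Suc i) - p i < \<delta>" for n p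
  proof -
    have p0: "p 0 = 0" "p n = t" "\<And>i. i < n \<Longrightarrow> p i < p (Suc i)"
      using p by (auto simp: interval_partition_def)
    have mono: "p i \<le> p j" if "i \<le> j" "j \<le> n" for i j
      using that
    proof (induction j rule: dec_induct)
      case (step k)
      then show ?case using p0(3)[of k] by linarith
    qed simp
    have step: "norm (y (p (Suc i)) - y (p i) - rough_summand X XX G z z' (p i) (p (Suc i)))
        \<le> K * \<delta> powr (\<beta> - 1) * (p (Suc i) - p i)" if "i < n" for i
    proof -
      define d where "d = p (Suc i) - p i"
      have d: "0 < d" "d \<le> \<delta>" using p0(3) mesh that by (auto simp: d_def less_imp_le)
      have "norm (y (p (Suc i)) - y (p i) - rough_summand X XX G z z' (p i) (p (Suc i))) \<le> K * d powr \<beta>"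
        unfolding d_def using mono[of 0 i] mono[of "Suc i" n] mono[of i "Suc i"] p0 that t
        by (intro bound) auto
      also have "d powr \<beta> = d powr (\<beta> - 1) * d"
        using d by (simp add: powr_diff)
      also have "\<dots> \<le> \<delta> powr (\<beta> - 1) * d"
        using d \<beta> by (intro mult_right_mono powr_mono2) auto
      finally show ?thesis using K by (simp add: d_def mult_left_mono mult.assoc)
    qed
    have "(\<Sum>i<n. y (p (Suc i)) - y (p i)) = y t - y 0"
      using sum_lessThan_telescope[of "\<lambda>i. y (p i)" n] p0 by simp
    then have "(\<Sum>i<n. rough_summand X XX G z z' (p i) (p (Suc i))) - (y t - y 0)
        = - (\<Sum>i<n. y (p (Suc i)) - y (p i) - rough_summand X XX G z z' (p i) (p (Suc i)))"
      by (simp add: sum_subtractf)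
    also have "norm \<dots> \<le> (\<Sum>i<n. K * \<delta> powr (\<beta> - 1) * (p (Suc i) - p i))"
      unfolding norm_minus_cancel using step by (intro sum_norm_le) auto
    also have "\<dots> = K * \<delta> powr (\<beta> - 1) * t"
      using sum_lessThan_telescope[of p n] p0 by (simp flip: sum_distrib_left)
    also have "\<dots> < \<epsilon>" using \<delta>(2)[of \<delta>] \<delta>(1) by (simp add: mult_ac)
    finally show ?thesis .
  qed
  with \<delta>(1) show "\<exists>\<delta>>0. \<forall>n p. interval_partition t n p \<and> (\<forall>i<n. p (Suc i) - p i < \<delta>) \<longrightarrow>
      norm ((\<Sum>i<n. rough_summand X XX G z z' (p i) (p (Suc i))) - (y t - y 0)) < \<epsilon>"
    by blast
qed

section \<open>Lipschitz drift paths and their derivatives\<close>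

lemma absolutely_continuous_path_if_lipschitz:
  assumes lip: "\<And>s t. \<lbrakk>0 \<le> s; s \<le> t; t \<le> S\<rbrakk> \<Longrightarrow> norm (x t - x s) \<le> L * (t - s)"
  shows "absolutely_continuous_path S x"
  unfolding absolutely_continuous_path_def
proof (intro allI impI)
  fix \<epsilon> :: real assume \<epsilon>: "0 < \<epsilon>"
  define \<delta> where "\<delta> = \<epsilon> / (\<bar>L\<bar> + 1)"
  have \<delta>: "0 < \<delta>" using \<epsilon> by (simp add: \<delta>_def)
  have "(\<Sum>i<n. norm (x (b i) - x (a i))) < \<epsilon>"
    if ab: "\<forall>i<n. 0 \<le> a i \<and> a i \<le> b i \<and> b i \<le> S" and small: "(\<Sum>i<n. b i - a i) < \<delta>" for n and a b :: "nat \<Rightarrow> real"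
  proof -
    have "norm (x (b i) - x (a i)) \<le> (\<bar>L\<bar> + 1) * (b i - a i)" if "i < n" for i
      using lip[of "a i" "b i"] ab that mult_right_mono[of L "\<bar>L\<bar> + 1" "b i - a i"] by force
    then have "(\<Sum>i<n. norm (x (b i) - x (a i))) \<le> (\<Sum>i<n. (\<bar>L\<bar> + 1) * (b i - a i))"
      by (intro sum_mono) auto
    also have "\<dots> = (\<bar>L\<bar> + 1) * (\<Sum>i<n. b i - a i)" by (simp flip: sum_distrib_left)
    also have "\<dots> < (\<bar>L\<bar> + 1) * \<delta>" using small by (intro mult_strict_left_mono) auto
    also have "\<dots> = \<epsilon>" by (simp add: \<delta>_def)
    finally show ?thesis .
  qed
  with \<delta> show "\<exists>\<delta>>0. \<forall>(n::nat) a b. (\<forall>i<n. 0 \<le> a i \<and> a i \<le> b i \<and> b i \<le> S) \<and>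
      (\<forall>i<n. \<forall>j<n. i \<noteq> j \<longrightarrow> {a i<..<b i} \<inter> {a j<..<b j} = {}) \<and>
      (\<Sum>i<n. b i - a i) < \<delta> \<longrightarrow> (\<Sum>i<n. norm (x (b i) - x (a i))) < \<epsilon>"
    by blast
qed

lemma right_derivative_limit:
  fixes x :: "real \<Rightarrow> 'a::real_normed_vector"
  assumes "(x has_vector_derivative D) (at s)"
  shows "((\<lambda>t. (1 / (t - s)) *\<^sub>R (x t - x s)) \<longlongrightarrow> D) (at_right s)"
proof -
  have "(x has_derivative (\<lambda>h. h *\<^sub>R D)) (at_right s)"
    using assms by (simp add: has_vector_derivative_def has_derivative_at_withinI)
  then have lim: "((\<lambda>t. (x t - x s - (t - s) *\<^sub>R D) /\<^sub>R \<bar>t - s\<bar>) \<longlongrightarrow> 0) (at_right s)"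
    by (simp add: has_derivative_within divide_inverse algebra_simps)
  have "((\<lambda>t. (1 / (t - s)) *\<^sub>R (x t - x s) - D) \<longlongrightarrow> 0) (at_right s)"
  proof (rule Lim_transform_eventually[OF lim])
    show "\<forall>\<^sub>F t in at_right s. (x t - x s - (t - s) *\<^sub>R D) /\<^sub>R \<bar>t - s\<bar> = (1 / (t - s)) *\<^sub>R (x t - x s) - D"
      unfolding eventually_at_filter
      by (intro always_eventually allI impI) (simp add: scaleR_diff_right divide_inverse)
  qed
  then show ?thesis by (simp add: LIM_zero_iff)
qed

text \<open>For fixed \<open>\<epsilon>\<close> the inflated set is closed and so contains the limit
  D of the right difference quotients; shrinking \<open>\<epsilon>\<close> puts D in the closure of
  F, which is F.\<close>

lemma derivative_in_convex_set:
  fixes x :: "real \<Rightarrow> 'a::euclidean_space"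
  assumes D: "(x has_vector_derivative D) (at s)" and F: "compact F"
    and near: "\<And>\<epsilon>. 0 < \<epsilon> \<Longrightarrow> \<exists>\<delta>>0. \<forall>t. s < t \<and> t < s + \<delta> \<longrightarrow>
      (1 / (t - s)) *\<^sub>R (x t - x s) \<in> {a + b |a b. a \<in> F \<and> b \<in> cball 0 \<epsilon>}"
  shows "D \<in> F"
proof -
  have close: "\<exists>a\<in>F. dist a D \<le> \<epsilon>" if \<epsilon>: "0 < \<epsilon>" for \<epsilon>
  proof -
    obtain \<delta> where \<delta>: "0 < \<delta>" "\<And>t. \<lbrakk>s < t; t < s + \<delta>\<rbrakk> \<Longrightarrow>
        (1 / (t - s)) *\<^sub>R (x t - x s) \<in> {a + b |a b. a \<in> F \<and> b \<in> cball 0 \<epsilon>}"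
      using near[OF \<epsilon>] by blast
    have ev: "\<forall>\<^sub>F t in at_right s. (1 / (t - s)) *\<^sub>R (x t - x s) \<in> {a + b |a b. a \<in> F \<and> b \<in> cball 0 \<epsilon>}"
      unfolding eventually_at_right_field using \<delta> by (intro exI[of _ "s + \<delta>"]) auto
    have "closed {a + b |a b. a \<in> F \<and> b \<in> cball 0 \<epsilon>}"
      by (intro compact_imp_closed compact_sums F compact_cball)
    then have "D \<in> {a + b |a b. a \<in> F \<and> b \<in> cball 0 \<epsilon>}"
      by (rule Lim_in_closed_set[OF _ ev trivial_limit_at_right_real right_derivative_limit[OF D]])
    then obtain a b where "D = a + b" "a \<in> F" "norm b \<le> \<epsilon>" by auto
    then show ?thesis by (intro bexI[of _ a]) (auto simp: dist_norm)
  qed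
  have "D \<in> closure F"
    unfolding closure_approachable
  proof (intro allI impI)
    fix e :: real assume "0 < e"
    then obtain a where "a \<in> F" "dist a D \<le> e / 2" using close[of "e / 2"] by auto
    with \<open>0 < e\<close> show "\<exists>a\<in>F. dist a D < e" by (intro bexI[of _ a]) auto
  qed
  then show ?thesis using F by (simp add: compact_imp_closed)
qed

text \<open>Mean value inequality on the segment for f minus its linearization at x, whose
  derivative there is at most L times the length of the segment.\<close>

lemma taylor_lipschitz_derivative:
  fixes f :: "'a::real_normed_vector \<Rightarrow> 'b::real_normed_vector"
  assumes f: "\<And>x. (f has_derivative blinfun_apply (Df x)) (at x)"
    and lip: "\<And>x y. norm (Df y - Df x) \<le> L * norm (y - x)" and "0 \<le> L"
  shows "norm (f y - f x - Df x (y - x)) \<le> L * (norm (y - x))\<^sup>2"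
proof -
  have "norm (f y - f x - blinfun_apply (Df x) (y - x)) \<le> norm (y - x) * (L * norm (y - x))"
  proof (rule differentiable_bound_linearization[where S = "closed_segment x y"])
    show "x + t *\<^sub>R (y - x) \<in> closed_segment x y" if "t \<in> {0..1}" for t
      using that by (auto simp: in_segment algebra_simps)
    show "(f has_derivative blinfun_apply (Df u)) (at u within closed_segment x y)" for u
      using f by (rule has_derivative_at_withinI)
    show "onorm (blinfun_apply (Df u) - blinfun_apply (Df x)) \<le> L * norm (y - x)"
      if "u \<in> closed_segment x y" for u
    proof -
      have "onorm (blinfun_apply (Df u) - blinfun_apply (Df x)) = norm (Df u - Df x)"
        by (simp add: norm_blinfun.rep_eq minus_blinfun.rep_eq fun_diff_def)
      also have "\<dots> \<le> L * norm (u - x)" by (rule lip)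
      also have "\<dots> \<le> L * norm (y - x)"
        using segment_bound1[OF that] \<open>0 \<le> L\<close> by (rule mult_left_mono)
      finally show ?thesis .
    qed
  qed auto
  then show ?thesis by (simp add: power2_eq_square mult_ac)
qed

lemma lipschitz_if_bounded_derivative:
  fixes f :: "'a::real_normed_vector \<Rightarrow> 'b::real_normed_vector"
  assumes f: "\<And>x. (f has_derivative blinfun_apply (Df x)) (at x)" and bd: "\<And>x. norm (Df x) \<le> L"
  shows "norm (f y - f x) \<le> L * norm (y - x)"
  using f bd by (intro differentiable_bound[of UNIV f "\<lambda>x. blinfun_apply (Df x)"])
    (auto simp: norm_blinfun.rep_eq)

text \<open>The derivative of z along X is G(z), with remainder order \<theta> = 2\<alpha>, so that
  \<alpha> + \<theta> = 3\<alpha> > 1 as a solution requires.\<close>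

theorem theorem1p3:
  fixes T \<alpha> \<gamma> :: real
    and \<xi> :: "real^'d"
    and X :: "real \<Rightarrow> real^'l"
    and XX :: "real \<Rightarrow> real \<Rightarrow> real^'l^'l"
    and G :: "real^'d \<Rightarrow> (real^'l) \<Rightarrow>\<^sub>L (real^'d)"
    and F :: "real \<times> (real^'d) \<Rightarrow> (real^'d) set"
  assumes "T > 0"
    and "1/3 < \<alpha>" and "\<alpha> \<le> 1/2"
    and "weak_geometric_rough_path \<alpha> T X XX"
    and "0 \<le> \<gamma>" and "\<gamma> \<le> 1" and "\<alpha> * (2 + \<gamma>) > 1"
    and "Cb2 \<gamma> G"
    and "upper_semicontinuous_on ({0..T} \<times> UNIV) F"
    and "locally_bounded_on ({0..T} \<times> UNIV) F"
    and "\<And>p. p \<in> {0..T} \<times> UNIV \<Longrightarrow> F p \<noteq> {} \<and> compact (F p) \<and> convex (F p)"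
  shows "\<exists>Tstar z. 0 < Tstar \<and> Tstar < T \<and> rdi_solution \<alpha> X XX F G \<xi> Tstar z"
proof -

  \<comment> \<open>Constants of the rough path and of the vector field\<close>
  have \<alpha>0: "0 < \<alpha>" using assms(2) by simp
  have rp: "rough_path \<alpha> T X XX"
    using assms(4) by (simp add: weak_geometric_rough_path_def)
  obtain cX where cX: "0 \<le> cX"
    "\<And>s t. \<lbrakk>0 \<le> s; s \<le> t; t \<le> T\<rbrakk> \<Longrightarrow> norm (X t - X s) \<le> cX * (t - s) powr \<alpha>"
    using rp holder_path_bound unfolding rough_path_def by metis
  obtain cXX where cXX: "0 \<le> cXX"
    "\<And>s t. \<lbrakk>s \<in> {0..T}; t \<in> {0..T}; s \<noteq> t\<rbrakk> \<Longrightarrow> norm (XX s t) \<le> cXX * \<bar>t - s\<bar> powr (2 * \<alpha>)"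
    using rp order_on_bound unfolding rough_path_def by metis
  have chen: "XX r t - XX r s - XX s t = (X s - X r) \<otimes>\<^sub>v (X t - X s)"
    if "0 \<le> r" "r \<le> s" "s \<le> t" "t \<le> T" for r s t
    using rp that unfolding rough_path_def increment_def by blast
  have XX_diag: "XX s s = 0" if "0 \<le> s" "s \<le> T" for s
  proof -
    have "(0 :: real^'l) \<otimes>\<^sub>v (0 :: real^'l) = 0" by (simp add: tensor_def vec_eq_iff)
    then show ?thesis using chen[of s s s] that by simp
  qed
  obtain DG D2G where DG: "\<And>y. (G has_derivative blinfun_apply (DG y)) (at y)"
    and D2G: "\<And>y. (DG has_derivative blinfun_apply (D2G y)) (at y)"
    and bdd: "bounded (range G)" "bounded (range DG)" "bounded (range D2G)"
    using assms(8) unfolding Cb2_def by metis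
  obtain c0 c1 c2 where c0: "\<And>y. norm (G y) \<le> c0" and c1: "\<And>y. norm (DG y) \<le> c1"
    and c2: "\<And>y. norm (D2G y) \<le> c2"
    using bdd unfolding bounded_iff by (metis rangeI)
  have c_nonneg: "0 \<le> c0" "0 \<le> c1" "0 \<le> c2"
    using order_trans[OF norm_ge_zero c0] order_trans[OF norm_ge_zero c1] order_trans[OF norm_ge_zero c2]
    by auto
  have G_lip: "norm (G y' - G y) \<le> c1 * norm (y' - y)" for y y'
    by (rule lipschitz_if_bounded_derivative[OF DG c1])
  have DG_lip: "norm (DG y' - DG y) \<le> c2 * norm (y' - y)" for y y'
    by (rule lipschitz_if_bounded_derivative[OF D2G c2])
  define A where "A y = tensor_blinfun (DG y o\<^sub>L G y)" for y
  define n where "n = (real CARD('l))\<^sup>2"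
  have n: "0 \<le> n" by (simp add: n_def)
  have A_bound: "norm (A y) \<le> n * (c1 * c0)" for y
  proof -
    have "norm (DG y o\<^sub>L G y) \<le> c1 * c0"
      using norm_blinfun_compose[of "DG y" "G y"] mult_mono[OF c1[of y] c0[of y]] c_nonneg by simp
    then show ?thesis
      using norm_tensor_blinfun[of "DG y o\<^sub>L G y"] n unfolding A_def n_def
      by (meson mult_left_mono order_trans)
  qed
  have A_lip: "norm (A y' - A y) \<le> n * (c2 * c0 + c1 * c1) * norm (y' - y)" for y y'
  proof -
    have eq: "(DG y' o\<^sub>L G y') - (DG y o\<^sub>L G y) = ((DG y' - DG y) o\<^sub>L G y') + (DG y o\<^sub>L (G y' - G y))"
      by (rule blinfun_eqI) (simp add: blinfun.diff_left blinfun.diff_right blinfun.add_left)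
    have "norm ((DG y' o\<^sub>L G y') - (DG y o\<^sub>L G y))
        \<le> norm (DG y' - DG y) * norm (G y') + norm (DG y) * norm (G y' - G y)"
      unfolding eq by (intro norm_triangle_mono norm_blinfun_compose)
    also have "\<dots> \<le> (c2 * norm (y' - y)) * c0 + c1 * (c1 * norm (y' - y))"
      using c_nonneg by (intro add_mono mult_mono DG_lip c0 c1 G_lip) auto
    also have "\<dots> = (c2 * c0 + c1 * c1) * norm (y' - y)" by (simp add: algebra_simps)
    finally show ?thesis
      using norm_tensor_blinfun[of "(DG y' o\<^sub>L G y') - (DG y o\<^sub>L G y)"] n
      unfolding A_def n_def tensor_blinfun_diff[symmetric] mult.assoc
      by (meson mult_left_mono order_trans)
  qed
  have A_tensor: "A y (a \<otimes>\<^sub>v b) = DG y (G y a) b" for y a b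
  proof -
    have "bilinear (\<lambda>a b. (DG y o\<^sub>L G y) a b)"
      by (simp add: bilinear_def linear_iff blinfun.add_right blinfun.add_left blinfun.scaleR_left blinfun.scaleR_right)
    then show ?thesis by (simp add: A_def tensor_blinfun_apply tensor_lift_tensor)
  qed
  \<comment> \<open>For z' = G(z) the bilinear map in \<open>rough_summand\<close> is the one lifted
    by \<open>A (z s)\<close>, so the compensated summand is exactly the rough part of the
    expansion; \<open>frechet_derivative\<close> agrees with the witness \<open>DG\<close> by
    uniqueness.\<close>
  have summand: "rough_summand X XX G z (\<lambda>t. G (z t)) s t = G (z s) (X t - X s) + A (z s) (XX s t)" for z s t
    by (simp add: rough_summand_def A_def tensor_blinfun_apply increment_def frechet_derivative_at[OF DG, symmetric])

  \<comment> \<open>Local selection and choice of the horizon\<close>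
  have "(0, \<xi>) \<in> {0..T} \<times> UNIV" using \<open>T > 0\<close> by simp
  from bspec[OF assms(10)[unfolded locally_bounded_on_def] this] obtain U0 where U0: "open U0" "(0, \<xi>) \<in> U0" "bounded (\<Union>q\<in>U0 \<inter> {0..T} \<times> UNIV. F q)"
    by blast
  obtain L where L: "\<And>q v. \<lbrakk>q \<in> U0; q \<in> {0..T} \<times> UNIV; v \<in> F q\<rbrakk> \<Longrightarrow> norm v \<le> L"
    using U0(3) unfolding bounded_iff by blast
  obtain r where r: "0 < r" "ball (0, \<xi>) r \<subseteq> U0" using U0 openE by blast
  define V where "V t y = (if (t, y) \<in> U0 \<and> t \<in> {0..T} then SOME v. v \<in> F (t, y) else 0)" for t y
  have V_in: "V t y \<in> F (t, y)" if "(t, y) \<in> U0" "t \<in> {0..T}" for t y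
    using that assms(11)[of "(t, y)"] by (auto simp: V_def some_in_eq)

  \<comment> \<open>\<open>V\<close> is cut off outside \<open>U0\<close> to be globally bounded; the horizon \<open>S\<close> below is chosen so small
    that the limit path stays in \<open>U0\<close>.\<close>
  define M where "M = 1 + \<bar>L\<bar> + cX + cXX + c0 + c1 + c2 + n * (c1 * c0) + n * (c2 * c0 + c1 * c1)"
  have "0 \<le> n * (c1 * c0)" "0 \<le> n * (c2 * c0 + c1 * c1)" using c_nonneg n by auto
  then have M: "1 \<le> M" "\<bar>L\<bar> \<le> M" "cX \<le> M" "cXX \<le> M" "c0 \<le> M" "c1 \<le> M" "c2 \<le> M"
      "n * (c1 * c0) \<le> M" "n * (c2 * c0 + c1 * c1) \<le> M"
    using c_nonneg cX(1) cXX(1) by (auto simp: M_def)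
  have V_bound: "norm (V t y) \<le> M" for t y
  proof (cases "(t, y) \<in> U0 \<and> t \<in> {0..T}")
    case True
    then have "norm (V t y) \<le> L" by (intro L[of "(t, y)"] V_in) auto
    then show ?thesis using M by simp
  qed (use M in \<open>auto simp: V_def\<close>)

  define K where "K = 46 * M ^ 6 / (1 - 2 powr (1 - 3 * \<alpha>))"
  have "2 powr (1 - 3 * \<alpha>) < 1" using assms(2) by (simp add: powr_less_one)
  then have "0 \<le> K" using M(1) by (simp add: K_def)
  then obtain d1 where d1: "0 < d1" "\<And>s. \<lbrakk>0 \<le> s; s \<le> d1\<rbrakk> \<Longrightarrow> K * s powr \<alpha> < 1"
    using powr_small[OF \<alpha>0, of K 1] by auto
  obtain d2 where d2: "0 < d2" "\<And>s. \<lbrakk>0 \<le> s; s \<le> d2\<rbrakk> \<Longrightarrow> 4 * M\<^sup>2 * s powr \<alpha> < r / 2"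
    using powr_small[OF \<alpha>0, of "4 * M\<^sup>2" "r / 2"] r(1) by auto
  \<comment> \<open>T / 2 puts S below T, r / 4 and \<open>d2\<close> keep time and space within r /
    2 of the start, 1 allows comparison of powers of lengths, and \<open>d1\<close> gives the
    smallness condition of the sewing.\<close>
  define S where "S = min (min (T / 2) (r / 4)) (min 1 (min d1 d2))"
  have S: "0 < S" "S < T" "S < r / 2" "S \<le> 1" "S \<le> d1" "S \<le> d2"
    using \<open>T > 0\<close> r(1) d1(1) d2(1) by (auto simp: S_def)

  interpret D: davie_data \<alpha> M S G DG A X XX
  proof
    show "norm (G y) \<le> M" "norm (DG y) \<le> M" "norm (A y) \<le> M" for y
      using c0[of y] c1[of y] A_bound[of y] M by linarith+
    show "norm (A y' - A y) \<le> M * norm (y' - y)" for y y'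
      using A_lip[of y' y] mult_right_mono[OF M(9), of "norm (y' - y)"] by simp
    show "norm (G y' - G y - DG y (y' - y)) \<le> M * (norm (y' - y))\<^sup>2" for y y'
      using taylor_lipschitz_derivative[OF DG DG_lip c_nonneg(3), of y' y]
        mult_right_mono[OF M(7), of "(norm (y' - y))\<^sup>2"] by simp
    show "norm (X t - X s) \<le> M * (t - s) powr \<alpha>" if "0 \<le> s" "s \<le> t" "t \<le> S" for s t
      using cX(2)[of s t] that S mult_right_mono[OF M(3), of "(t - s) powr \<alpha>"] by simp
    show "norm (XX s t) \<le> M * (t - s) powr (2 * \<alpha>)" if "0 \<le> s" "s \<le> t" "t \<le> S" for s t
    proof (cases "s = t")
      case False
      then have "norm (XX s t) \<le> cXX * (t - s) powr (2 * \<alpha>)"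
        using cXX(2)[of s t] that S by simp
      also have "\<dots> \<le> M * (t - s) powr (2 * \<alpha>)"
        using M(4) by (intro mult_right_mono) auto
      finally show ?thesis .
    qed (use XX_diag that S in auto)
    show "A y (XX r t) = A y (XX r s) + A y (XX s t) + DG y (G y (X s - X r)) (X t - X s)"
      if "0 \<le> r" "r \<le> s" "s \<le> t" "t \<le> S" for r s t y
    proof -
      have "XX r t = XX r s + XX s t + (X s - X r) \<otimes>\<^sub>v (X t - X s)"
        using chen[of r s t] that S by (simp add: algebra_simps)
      then show ?thesis by (simp only: blinfun.add_right A_tensor)
    qed
    show "continuous_on UNIV G"
      using DG by (meson continuous_at_imp_continuous_on has_derivative_continuous)
    show "(\<lambda>n. XX (s' n) (t' n)) \<longlonglongrightarrow> XX s t"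
      if "s' \<longlonglongrightarrow> s" "t' \<longlonglongrightarrow> t" "\<And>n. 0 \<le> s' n" "\<And>n. s' n \<le> t' n" "\<And>n. t' n \<le> S" for s' s t' t
      using that(5) S(2) by (intro rough_path_continuous[OF rp \<alpha>0 that(1-4)]) (meson less_imp_le order_trans)
    show "46 * M ^ 6 / (1 - 2 powr (1 - 3 * \<alpha>)) * S powr \<alpha> \<le> 1"
      using d1(2)[of S] S by (simp add: K_def)
  qed (use assms(2,3) M S in auto)

  obtain z x where z0: "z 0 = \<xi>" and x0: "x 0 = 0"
    and x_lip: "\<And>s t. \<lbrakk>0 \<le> s; s \<le> t; t \<le> S\<rbrakk> \<Longrightarrow> norm (x t - x s) \<le> M * (t - s)"
    and rem: "\<And>s t. \<lbrakk>0 \<le> s; s \<le> t; t \<le> S\<rbrakk> \<Longrightarrow>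
          norm (D.remainder s t (z s) (z t) (x t - x s)) \<le> D.K * (t - s) powr (3 * \<alpha>)"
    and drift: "\<And>s C U. \<lbrakk>closed C; convex C; open U; 0 \<le> s; s < S; (s, z s) \<in> U;
          \<forall>t y. (t, y) \<in> U \<and> 0 \<le> t \<and> t \<le> S \<longrightarrow> V t y \<in> C\<rbrakk> \<Longrightarrow>
          \<exists>\<delta>>0. \<forall>t. s < t \<and> t < s + \<delta> \<and> t \<le> S \<longrightarrow> (1 / (t - s)) *\<^sub>R (x t - x s) \<in> C"
  proof -
    show ?thesis
    proof (rule D.davie_solution_exists[of V \<xi>, OF V_bound], goal_cases)
      case (1 z x)
      show ?case by (rule that[of z x, OF 1])
    qed
  qed
  have first_order: "norm (z t - z s - G (z s) (X t - X s)) \<le> 3 * M\<^sup>2 * (t - s) powr (2 * \<alpha>)"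
    and z_holder: "norm (z t - z s) \<le> 4 * M\<^sup>2 * (t - s) powr \<alpha>"
    if "0 \<le> s" "s \<le> t" "t \<le> S" for s t
    using D.increment_bounds[OF that x_lip[OF that] rem[OF that]] by auto
  have in_U0: "(t, z t) \<in> U0" if "t \<in> {0..S}" for t
  proof -
    have "norm (z t - \<xi>) \<le> 4 * M\<^sup>2 * t powr \<alpha>" using z_holder[of 0 t] that z0 by simp
    also have "\<dots> < r / 2" using that S by (intro d2(2)) auto
    finally have "dist \<xi> (z t) < r / 2" by (simp add: dist_norm norm_minus_commute)
    moreover have "dist (0, \<xi>) (t, z t) \<le> dist 0 t + dist \<xi> (z t)"
      unfolding dist_Pair_Pair fst_conv snd_conv by (rule sqrt_sum_squares_le_sum) auto
    ultimately have "dist (0, \<xi>) (t, z t) < r" using that S by simp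
    then show ?thesis using r(2) by auto
  qed

  \<comment> \<open>The inclusion for the derivative of the drift\<close>
  have "AE t in lebesgue_on {0..S}. \<exists>v\<in>F (t, z t). (x has_vector_derivative v) (at t within {0..S})"
  proof -
    \<comment> \<open>Constant extension beyond [0, S], since almost everywhere differentiability
      was shown for paths that are Lipschitz on the whole line.\<close>
    define x' where "x' t = x (max 0 (min S t))" for t
    have x'_eq: "x' t = x t" if "t \<in> {0..S}" for t using that by (simp add: x'_def max_absorb2 min_absorb2)
    have "norm (x' t - x' s) \<le> M * \<bar>t - s\<bar>" if "s \<le> t" for s t
    proof -
      have "norm (x' t - x' s) \<le> M * (max 0 (min S t) - max 0 (min S s))"
        unfolding x'_def using that S(1) by (intro x_lip) auto
      also have "\<dots> \<le> M * \<bar>t - s\<bar>" using M(1) that by (intro mult_left_mono) auto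
      finally show ?thesis .
    qed
    then have "norm (x' s - x' t) \<le> M * \<bar>s - t\<bar>" for s t
      by (metis abs_minus_commute nle_le norm_minus_commute)
    then obtain N where N: "negligible N"
      "\<And>t. t \<notin> N \<Longrightarrow> (x' has_vector_derivative vector_derivative x' (at t)) (at t)"
      using lipschitz_AE_vector_differentiable by metis
    \<comment> \<open>\<open>drift\<close> speaks of quotients to the right of t, so t = S is
      excluded; it joins the null set below.\<close>
    have good: "\<exists>v\<in>F (t, z t). (x has_vector_derivative v) (at t within {0..S})"
      if t: "t \<in> {0..S}" "t \<notin> N" "t \<noteq> S" for t
    proof
      define D where "D = vector_derivative x' (at t)"
      have D: "(x' has_vector_derivative D) (at t)" using N(2) t by (simp add: D_def)
      have "(x' has_vector_derivative D) (at t within {0..S})"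
        using D by (rule has_vector_derivative_at_within)
      then show "(x has_vector_derivative D) (at t within {0..S})"
        using has_vector_derivative_transform[of t "{0..S}" x x' D] t(1) x'_eq by simp
      have tS: "0 \<le> t" "t < S" and tT: "(t, z t) \<in> {0..T} \<times> UNIV" using t S by auto
      have F: "compact (F (t, z t))" "convex (F (t, z t))" using assms(11)[OF tT] by auto
      show "D \<in> F (t, z t)"
      proof (rule derivative_in_convex_set[OF D F(1)])
        fix \<epsilon> :: real assume \<epsilon>: "0 < \<epsilon>"
        \<comment> \<open>Two inflations of the value set: the open \<open>W\<close> is a
          neighbourhood to which upper semicontinuity applies, the larger closed \<open>C\<close> is
          what passes to the limit. \<open>C\<close> is convex as a Minkowski sum of convex sets,
          which is where convexity of the values enters.\<close>
        define C where "C = {a + b |a b. a \<in> F (t, z t) \<and> b \<in> cball 0 \<epsilon>}"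
        define W where "W = {a + b |a b. a \<in> F (t, z t) \<and> b \<in> ball 0 \<epsilon>}"
        have "closed C"
          unfolding C_def by (intro compact_imp_closed compact_sums F compact_cball)
        moreover have "C = (\<Union>a\<in>F (t, z t). \<Union>b\<in>cball 0 \<epsilon>. {a + b})"
          unfolding C_def by blast
        then have "convex C"
          using convex_sums[OF F(2) convex_cball] by simp
        ultimately have C: "closed C" "convex C" by auto
        have "open W"
        proof -
          have "W = (\<Union>a\<in>F (t, z t). ball a \<epsilon>)"
            by (force simp: W_def dist_norm norm_minus_commute)
          then show ?thesis by auto
        qed
        moreover have "F (t, z t) \<subseteq> W" unfolding W_def using \<epsilon> by force
        ultimately obtain U where U: "open U" "(t, z t) \<in> U" "\<And>q. q \<in> U \<inter> {0..T} \<times> UNIV \<Longrightarrow> F q \<subseteq> W"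
          using assms(9) tT unfolding upper_semicontinuous_on_def by meson
        have "W \<subseteq> C" unfolding W_def C_def by force
        have VC: "V s y \<in> C" if "(s, y) \<in> U \<inter> U0" "0 \<le> s" "s \<le> S" for s y
        proof -
          have "V s y \<in> F (s, y)" using that S by (intro V_in) auto
          also have "F (s, y) \<subseteq> W" using that S by (intro U(3)) auto
          finally show ?thesis using \<open>W \<subseteq> C\<close> by blast
        qed
        \<comment> \<open>Intersecting with \<open>U0\<close> is essential: outside it
          \<open>V\<close> is 0 and need not lie in \<open>C\<close>. The point (t, z t) lies in
          \<open>U0\<close> by the choice of the horizon.\<close>
        obtain \<delta> where \<delta>: "0 < \<delta>"
          "\<And>s. \<lbrakk>t < s; s < t + \<delta>; s \<le> S\<rbrakk> \<Longrightarrow> (1 / (s - t)) *\<^sub>R (x s - x t) \<in> C"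
          using drift[OF C open_Int[OF U(1) U0(1)] tS] VC U(2) in_U0[OF t(1)] by blast
        have "(1 / (s - t)) *\<^sub>R (x' s - x' t) \<in> C" if "t < s" "s < t + min \<delta> (S - t)" for s
          using \<delta>(2)[of s] that tS x'_eq by simp
        then show "\<exists>\<delta>>0. \<forall>s. t < s \<and> s < t + \<delta> \<longrightarrow> (1 / (s - t)) *\<^sub>R (x' s - x' t)
            \<in> {a + b |a b. a \<in> F (t, z t) \<and> b \<in> cball 0 \<epsilon>}"
          using \<delta>(1) tS unfolding C_def by (intro exI[of _ "min \<delta> (S - t)"]) auto
      qed
    qed
    have "negligible (insert S N)" using N(1) by simp
    then have "AE t in lebesgue. t \<notin> insert S N"
      by (intro AE_not_in) (simp add: negligible_iff_null_sets)
    then have "AE t in lebesgue. t \<in> {0..S} \<longrightarrow>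
        (\<exists>v\<in>F (t, z t). (x has_vector_derivative v) (at t within {0..S}))"
      by eventually_elim (use good in auto)
    then show ?thesis by (subst AE_restrict_space_iff) auto
  qed

  \<comment> \<open>The integral equation\<close>
  moreover have "\<exists>I. has_rough_integral X XX G z (\<lambda>t. G (z t)) t I \<and> z t = \<xi> + x t + I"
    if "t \<in> {0..S}" for t
  proof -
    \<comment> \<open>Removing the drift leaves a path whose local expansion is purely rough and
      whose initial value is \<xi>.\<close>
    define y where "y t = z t - x t" for t
    have "has_rough_integral X XX G z (\<lambda>t. G (z t)) t (y t - y 0)"
    proof (rule has_rough_integral_if_davie)
      show "norm (y t - y s - rough_summand X XX G z (\<lambda>t. G (z t)) s t)
          \<le> D.K * (t - s) powr (3 * \<alpha>)" if "0 \<le> s" "s \<le> t" "t \<le> S" for s t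
        using rem[OF that] by (simp add: y_def summand D.remainder_def algebra_simps)
    qed (use that D.K_nonneg assms(2) in auto)
    then show ?thesis
      by (intro exI[of _ "y t - y 0"]) (simp add: y_def z0 x0)
  qed

  \<comment> \<open>The solution as a controlled path\<close>
  moreover have "controlled_path \<alpha> (2 * \<alpha>) S X z (\<lambda>t. G (z t))"
    unfolding controlled_path_def
  proof (intro conjI exI ballI)
    show "holder_path \<alpha> S z" using z_holder by (intro holder_pathI[where C = "4 * M\<^sup>2"]) auto
    have "norm (G (z t) - G (z s)) \<le> c1 * (4 * M\<^sup>2) * (t - s) powr \<alpha>" if "0 \<le> s" "s < t" "t \<le> S" for s t
      using G_lip[of "z t" "z s"] mult_left_mono[OF z_holder[of s t] c_nonneg(2)] that by simp
    then show "holder_path (2 * \<alpha> - \<alpha>) S (\<lambda>t. G (z t))"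
      by (intro holder_pathI) simp
    define R where "R s t = z t - z s - G (z s) (X t - X s)" for s t
    show "increment z s t = G (z s) (increment X s t) + R s t" for s t
      by (simp add: R_def increment_def)
    show "order_on (2 * \<alpha>) S R"
    proof (rule order_onI)
      fix s t assume st: "0 \<le> s" "s < t" "t \<le> S"
      have fwd: "norm (R s t) \<le> 3 * M\<^sup>2 * (t - s) powr (2 * \<alpha>)"
        using first_order[of s t] st by (simp add: R_def)
      have "norm ((G (z t) - G (z s)) (X t - X s)) \<le> norm (G (z t) - G (z s)) * norm (X t - X s)"
        by (rule norm_blinfun)
      also have "\<dots> \<le> (c1 * (4 * M\<^sup>2 * (t - s) powr \<alpha>)) * (cX * (t - s) powr \<alpha>)"
        using G_lip[of "z t" "z s"] mult_left_mono[OF z_holder[of s t] c_nonneg(2)] cX(2)[of s t] st S c_nonneg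
        by (intro mult_mono) auto
      also have "\<dots> = c1 * 4 * M\<^sup>2 * cX * (t - s) powr (2 * \<alpha>)"
        by (simp flip: powr_add)
      finally have cross: "norm ((G (z t) - G (z s)) (X t - X s)) \<le> c1 * 4 * M\<^sup>2 * cX * (t - s) powr (2 * \<alpha>)" .
      show "norm (R s t) \<le> (3 * M\<^sup>2 + c1 * 4 * M\<^sup>2 * cX) * (t - s) powr (2 * \<alpha>)"
        using fwd c_nonneg cX(1) by (simp add: distrib_right add_increasing2)
      \<comment> \<open>Reversing time changes the base point of G from z s to z t; the correction
        is a product of two increments of order \<alpha>, hence again of order 2\<alpha>.\<close>
      have "R t s = (G (z t) - G (z s)) (X t - X s) - R s t"
        by (simp add: R_def blinfun.diff_left blinfun.diff_right)
      then have "norm (R t s) \<le> norm ((G (z t) - G (z s)) (X t - X s)) + norm (R s t)"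
        by (simp add: norm_triangle_ineq4)
      then show "norm (R t s) \<le> (3 * M\<^sup>2 + c1 * 4 * M\<^sup>2 * cX) * (t - s) powr (2 * \<alpha>)"
        using fwd cross by (simp add: distrib_right)
    qed
  qed (use \<alpha>0 in auto)
  moreover have "absolutely_continuous_path S x"
    using x_lip by (rule absolutely_continuous_path_if_lipschitz)
  ultimately have "rdi_solution \<alpha> X XX F G \<xi> S z"
    unfolding rdi_solution_def using x0 assms(2)
    by (intro exI[of _ "\<lambda>t. G (z t)"] exI[of _ "2 * \<alpha>"] exI[of _ x]) auto
  then show ?thesis using S by blast
qed

end
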